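(* Let $\mathbb{T}$ be a time scale with $\sup\mathbb{T}=\infty$, $t_0\in\mathbb{T}$, let $A:[t_0,\infty)_{\mathbb{T}}\to[0,\infty)$ and $\alpha:[t_0,\infty)_{\mathbb{T}}\to\mathbb{T}$ be rd-continuous with $\lim_{t\to\infty}\alpha(t)=\infty$, and consider the delay dynamic equation $$x^{\Delta}(t)+A(t)x(\alpha(t))=0,\qquad t\in[t_0,\infty)_{\mathbb{T}}. \quad (E)$$ Assume that $\alpha(\sigma(t))\le t$ for all $t\in[t_0,\infty)_{\mathbb{T}}$, and that $$\sup_{s\in[t_0,\infty)_{\mathbb{T}}}\int_s^{\alpha_{-1}(s)}A(\eta)\,\Delta\eta<\infty ,\qquad \int_{t_0}^{\infty}A(\eta)\,\Delta\eta=\infty,\qquad \sup_{t\in[t_0,\infty)_{\mathbb{T}}}\int_{\alpha_*(t)}^{t}A(\eta)\,\Delta\eta<1 .$$ Then the trivial solution of (E) is globally asymptotically stable.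
   Context: Time scales: a time scale $\mathbb{T}$ is a nonempty closed subset of $\mathbb{R}$; an interval with subscript $\mathbb{T}$ means its intersection with $\mathbb{T}$. $\sigma(t)=\inf(t,\infty)_{\mathbb{T}}$, $\mu(t)=\sigma(t)-t$; $t$ is right-dense if $\mu(t)=0$, right-scattered otherwise; left-dense and left-scattered points are defined similarly with $\rho(t)=\sup(-\infty,t)_{\mathbb{T}}$. $f^{\Delta}(t)$ is the $\Delta$-derivative: the number such that for every $\varepsilon>0$ there is a neighbourhood $U$ of $t$ in $\mathbb T$ with $|f(\sigma(t))-f(r)-f^{\Delta}(t)(\sigma(t)-r)|\le\varepsilon|\sigma(t)-r|$ for all $r\in U$. A function is rd-continuous if it is continuous at right-dense points and has finite limits at left-dense points. The $\Delta$-integral of an rd-continuous $f$ is $\int_s^t f(\eta)\Delta\eta=F(t)-F(s)$ with $F^{\Delta}=f$. Delay functions: $\alpha_*(t):=\inf\{\alpha(\eta):\eta\in[t,\infty)_{\mathbb{T}}\}$ and $\alpha_{-1}(t):=\sup\{\eta\in[t_0,\infty)_{\mathbb{T}}:\alpha_*(\eta)\le t\}$ for $t\in[t_0,\infty)_{\mathbb T}$. Initial value problem: for $s\in[t_0,\infty)_{\mathbb{T}}$, a solution of (E) with data $(s,x_0,\varphi)$ is a function $x:[\alpha_*(s),\infty)_{\mathbb{T}}\to\mathbb{R}$ that is rd-continuous on $[\alpha_*(s),s]_{\mathbb{T}}$, is $\Delta$-differentiable on $[s,\infty)_{\mathbb{T}}$ with an rd-continuous derivative, satisfies $x^{\Delta}(t)+A(t)x(\alpha(t))=0$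 identically on $[s,\infty)_{\mathbb{T}}$, and has $x(s)=x_0$ and $x(t)=\varphi(t)$ for $t\in[\alpha_*(s),s)_{\mathbb{T}}$. Stability notions for the trivial solution. Uniformly stable: for every $\varepsilon>0$ there is $\delta>0$ such that for every $s\in[t_0,\infty)_{\mathbb{T}}$, every solution $x$ with data $(s,x_0,\varphi)$ satisfying $|x_0|+\sup_{\eta\in[\alpha_*(s),s)_{\mathbb{T}}}|\varphi(\eta)|<\delta$ satisfies $|x(t)|<\varepsilon$ for all $t\in[s,\infty)_{\mathbb{T}}$. Globally attracting: for every $s\in[t_0,\infty)_{\mathbb T}$, every solution with data $(s,x_0,\varphi)$ satisfies $\lim_{t\to\infty}x(t)=0$. Globally asymptotically stable: uniformly stable and globally attracting.
   Formalization: The delay condition α(t) ≤ t for all t in [t_0,∞)_T is assumed explicitly; without it the equation may be advanced at left-dense right-scattered points (or at t_0), and the claim as printed then fails. *)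

theory Defs
  imports "HOL-Analysis.Analysis"
begin

text \<open>A function on a subset of a time scale is modelled by a total function on the reals;
  every definition below reads it only on the intended subset.\<close>

definition time_scale :: "real set \<Rightarrow> bool" where
  "time_scale T \<longleftrightarrow> T \<noteq> {} \<and> closed T"

text \<open>The conditionals implement the usual conventions \<open>inf {} = sup T\<close> and \<open>sup {} = inf T\<close>
  at a greatest resp. least point of \<open>T\<close>.\<close>

definition fwd_jump :: "real set \<Rightarrow> real \<Rightarrow> real" where
  "fwd_jump T t = (if T \<inter> {t<..} = {} then t else Inf (T \<inter> {t<..}))"

definition bwd_jump :: "real set \<Rightarrow> real \<Rightarrow> real" where
  "bwd_jump T t = (if T \<inter> {..<t} = {} then t else Sup (T \<inter> {..<t}))"

definition graininess :: "real set \<Rightarrow> real \<Rightarrow> real" where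
  "graininess T t = fwd_jump T t - t"

definition right_dense :: "real set \<Rightarrow> real \<Rightarrow> bool" where
  "right_dense T t \<longleftrightarrow> graininess T t = 0"

definition left_dense :: "real set \<Rightarrow> real \<Rightarrow> bool" where
  "left_dense T t \<longleftrightarrow> bwd_jump T t = t"

definition has_delta_deriv :: "real set \<Rightarrow> (real \<Rightarrow> real) \<Rightarrow> real \<Rightarrow> real \<Rightarrow> bool" where
  "has_delta_deriv T f D t \<longleftrightarrow>
     (\<forall>\<epsilon>>0. \<exists>U. open U \<and> t \<in> U \<and>
        (\<forall>r \<in> U \<inter> T. \<bar>f (fwd_jump T t) - f r - D * (fwd_jump T t - r)\<bar>
                        \<le> \<epsilon> * \<bar>fwd_jump T t - r\<bar>))"

text \<open>Rd-continuity of the restriction of \<open>f\<close> to \<open>I \<subseteq> T\<close>: points are classified in \<open>T\<close>,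
  while continuity and left-hand limits are those of the restriction.\<close>

definition rd_continuous_on :: "real set \<Rightarrow> real set \<Rightarrow> (real \<Rightarrow> real) \<Rightarrow> bool" where
  "rd_continuous_on T I f \<longleftrightarrow>
     (\<forall>t \<in> I. (right_dense T t \<longrightarrow> continuous (at t within I) f) \<and>
              (left_dense T t \<longrightarrow> (\<exists>l. (f \<longlongrightarrow> l) (at t within (I \<inter> {..<t})))))"

text \<open>For rd-continuous \<open>f\<close> an antiderivative on \<open>T\<close> exists and is unique up to a constant,
  so the choice of \<open>F\<close> does not matter.\<close>

definition delta_antideriv :: "real set \<Rightarrow> (real \<Rightarrow> real) \<Rightarrow> real \<Rightarrow> real" where
  "delta_antideriv T f = (SOME F. \<forall>t \<in> T. has_delta_deriv T F (f t) t)"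

definition delta_integral :: "real set \<Rightarrow> (real \<Rightarrow> real) \<Rightarrow> real \<Rightarrow> real \<Rightarrow> real" where
  "delta_integral T f s t = delta_antideriv T f t - delta_antideriv T f s"

definition at_top_in :: "real set \<Rightarrow> real filter" where
  "at_top_in T = inf at_top (principal T)"

definition lower_delay :: "real set \<Rightarrow> (real \<Rightarrow> real) \<Rightarrow> real \<Rightarrow> real" where
  "lower_delay T \<alpha> t = Inf (\<alpha> ` (T \<inter> {t..}))"

definition delay_inverse :: "real set \<Rightarrow> real \<Rightarrow> (real \<Rightarrow> real) \<Rightarrow> real \<Rightarrow> real" where
  "delay_inverse T t0 \<alpha> t = Sup {\<eta> \<in> T \<inter> {t0..}. lower_delay T \<alpha> \<eta> \<le> t}"

text \<open>On \<open>[s, \<infinity>)\<close> the derivative is taken in the time scale \<open>T \<inter> {s..}\<close>, so that at a left-dense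
  \<open>s\<close> it is one-sided and does not involve the initial function.\<close>

definition dde_solution ::
  "real set \<Rightarrow> (real \<Rightarrow> real) \<Rightarrow> (real \<Rightarrow> real) \<Rightarrow> real \<Rightarrow> real \<Rightarrow> (real \<Rightarrow> real) \<Rightarrow> (real \<Rightarrow> real) \<Rightarrow> bool"
where
  "dde_solution T A \<alpha> s x0 \<phi> x \<longleftrightarrow>
     rd_continuous_on T (T \<inter> {lower_delay T \<alpha> s..s}) x \<and>
     (\<exists>x'. (\<forall>t \<in> T \<inter> {s..}. has_delta_deriv (T \<inter> {s..}) x (x' t) t) \<and>
           rd_continuous_on T (T \<inter> {s..}) x' \<and>
           (\<forall>t \<in> T \<inter> {s..}. x' t + A t * x (\<alpha> t) = 0)) \<and>
     x s = x0 \<and>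
     (\<forall>t \<in> T \<inter> {lower_delay T \<alpha> s..<s}. x t = \<phi> t)"

text \<open>The supremum is taken in \<open>ennreal\<close>, where it is \<open>0\<close> over an empty initial interval.\<close>

definition uniformly_stable :: "real set \<Rightarrow> real \<Rightarrow> (real \<Rightarrow> real) \<Rightarrow> (real \<Rightarrow> real) \<Rightarrow> bool" where
  "uniformly_stable T t0 A \<alpha> \<longleftrightarrow>
     (\<forall>\<epsilon>>0. \<exists>\<delta>>0. \<forall>s \<in> T \<inter> {t0..}. \<forall>x0 \<phi> x.
        dde_solution T A \<alpha> s x0 \<phi> x \<longrightarrow>
        ennreal \<bar>x0\<bar> + (SUP \<eta> \<in> T \<inter> {lower_delay T \<alpha> s..<s}. ennreal \<bar>\<phi> \<eta>\<bar>) < ennreal \<delta> \<longrightarrow>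
        (\<forall>t \<in> T \<inter> {s..}. \<bar>x t\<bar> < \<epsilon>))"

definition globally_attracting :: "real set \<Rightarrow> real \<Rightarrow> (real \<Rightarrow> real) \<Rightarrow> (real \<Rightarrow> real) \<Rightarrow> bool" where
  "globally_attracting T t0 A \<alpha> \<longleftrightarrow>
     (\<forall>s \<in> T \<inter> {t0..}. \<forall>x0 \<phi> x. dde_solution T A \<alpha> s x0 \<phi> x \<longrightarrow> (x \<longlongrightarrow> 0) (at_top_in T))"

definition globally_asymptotically_stable ::
  "real set \<Rightarrow> real \<Rightarrow> (real \<Rightarrow> real) \<Rightarrow> (real \<Rightarrow> real) \<Rightarrow> bool" where
  "globally_asymptotically_stable T t0 A \<alpha> \<longleftrightarrow>
     uniformly_stable T t0 A \<alpha> \<and> globally_attracting T t0 A \<alpha>"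

end

theory Submission
  imports Defs
begin

text \<open>Let \<open>F\<close> be an antiderivative of \<open>A\<close> and \<open>\<kappa> < 1\<close> a bound for its increments over
  \<open>[\<alpha>\<^sub>*(t), t]\<close>; since \<open>\<alpha>(\<sigma>(t)) \<le> t\<close>, the jumps of \<open>F\<close> are at most \<open>\<kappa>\<close> as well.
  On \<open>[s, \<alpha>\<^sub>-\<^sub>1(s)]\<close>, where the delay may still reach the initial function, a Gronwall estimate bounds
  \<open>x\<close> by a constant multiple of the initial data.

  Afterwards, suppose that \<open>x\<close> takes at \<open>t\<close> a positive value exceeding all values on \<open>[v, t)\<close>, while
  \<open>\<bar>x\<bar> \<le> N\<close> in the past. Then \<open>x \<circ> \<alpha>\<close> is negative somewhere just before \<open>t\<close>, so the last point \<open>\<xi>\<close> with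
  \<open>x(\<xi>) \<le> 0\<close> lies at most one delay before \<open>t\<close>, and integrating from \<open>\<xi>\<close> to \<open>t\<close> gives \<open>x(t) \<le> \<kappa> N\<close>.
  So no maximum can exceed the earlier bound. Moreover, a solution with values above \<open>\<kappa> N\<close> at arbitrarily
  late times stays above \<open>\<kappa> N\<close>, which the divergence of \<open>F\<close> forbids. Hence an eventual bound \<open>N\<close>
  improves to \<open>\<kappa> N\<close>, and iterating gives \<open>x \<rightarrow> 0\<close>.\<close>

section \<open>Delta derivatives and monotonicity\<close>

lemma fwd_jump_ge: "t \<le> fwd_jump T t"
  unfolding fwd_jump_def by (auto intro!: cInf_greatest)

lemma fwd_jump_le:
  assumes "b \<in> T" "t < b"
  shows "fwd_jump T t \<le> b"
proof -
  have "bdd_below (T \<inter> {t<..})" by (rule bdd_belowI[of _ t]) auto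
  then show ?thesis unfolding fwd_jump_def using assms by (auto intro!: cInf_lower)
qed

lemma fwd_jump_in:
  assumes "closed T" "t \<in> T"
  shows "fwd_jump T t \<in> T"
proof (cases "T \<inter> {t<..} = {}")
  case True
  then show ?thesis using assms by (simp add: fwd_jump_def)
next
  case False
  have "bdd_below (T \<inter> {t<..})" by (rule bdd_belowI[of _ t]) auto
  then have "Inf (T \<inter> {t<..}) \<in> closure (T \<inter> {t<..})"
    using False by (intro closure_contains_Inf)
  moreover have "closure (T \<inter> {t<..}) \<subseteq> T"
    using assms(1) by (intro closure_minimal) auto
  ultimately show ?thesis using False by (auto simp: fwd_jump_def)
qed

lemma fwd_jump_eqI:
  assumes "t' \<in> T" "t < t'" "T \<inter> {t<..<t'} = {}"
  shows "fwd_jump T t = t'"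
proof (rule antisym)
  show "fwd_jump T t \<le> t'" by (rule fwd_jump_le) fact+
  have "T \<inter> {t<..} \<noteq> {}" using assms by auto
  then show "t' \<le> fwd_jump T t"
    using assms unfolding fwd_jump_def by (force intro!: cInf_greatest simp: not_less)
qed

lemma fwd_jump_restrict: "s \<le> t \<Longrightarrow> fwd_jump (T \<inter> {s..}) t = fwd_jump T t"
proof -
  assume "s \<le> t"
  then have "T \<inter> {s..} \<inter> {t<..} = T \<inter> {t<..}" by auto
  then show ?thesis by (simp add: fwd_jump_def)
qed

text \<open>The point \<open>b\<close> rules out a greatest point of \<open>T\<close>, where
  \<open>fwd_jump T t = t\<close> holds by convention although nothing lies to the right.\<close>

lemma right_dense_point_between:
  assumes "fwd_jump T t = t" "b \<in> T" "t < b" "t < c"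
  shows "\<exists>y \<in> T. t < y \<and> y < c"
proof (rule ccontr)
  assume n: "\<not> ?thesis"
  have ne: "T \<inter> {t<..} \<noteq> {}" using assms by auto
  have "c \<le> Inf (T \<inter> {t<..})"
    by (rule cInf_greatest[OF ne]) (use n in force)
  then show False using assms ne by (simp add: fwd_jump_def)
qed

text \<open>The forward jump looks only to the right of \<open>t\<close>, so cutting
  \<open>T\<close> off at \<open>s'\<close> keeps it and merely leaves fewer points \<open>r\<close>
  to test.\<close>

lemma has_delta_deriv_restrict:
  assumes "has_delta_deriv (T \<inter> {s..}) f D t" "s \<le> s'" "s' \<le> t"
  shows "has_delta_deriv (T \<inter> {s'..}) f D t"
proof -
  have "fwd_jump (T \<inter> {s'..}) t = fwd_jump (T \<inter> {s..}) t"
    using assms by (simp add: fwd_jump_restrict)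
  moreover have "U \<inter> (T \<inter> {s'..}) \<subseteq> U \<inter> (T \<inter> {s..})" for U using assms by auto
  ultimately show ?thesis
    using assms(1) unfolding has_delta_deriv_def by (metis (no_types, lifting) subsetD)
qed

lemma has_delta_deriv_cmult_add:
  assumes "has_delta_deriv T f D t" "has_delta_deriv T g E t"
  shows "has_delta_deriv T (\<lambda>r. c * f r + g r) (c * D + E) t"
  unfolding has_delta_deriv_def
proof (intro allI impI)
  fix \<epsilon> :: real assume e: "\<epsilon> > 0"
  define e1 where "e1 = \<epsilon> / (2 * (\<bar>c\<bar> + 1))"
  have e1: "e1 > 0" "\<bar>c\<bar> * e1 \<le> \<epsilon> / 2"
    using e by (auto simp: e1_def field_simps)
  obtain U where U: "open U" "t \<in> U" "\<And>r. r \<in> U \<inter> T \<Longrightarrow>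
      \<bar>f (fwd_jump T t) - f r - D * (fwd_jump T t - r)\<bar> \<le> e1 * \<bar>fwd_jump T t - r\<bar>"
    using assms(1) e1 unfolding has_delta_deriv_def by meson
  obtain V where V: "open V" "t \<in> V" "\<And>r. r \<in> V \<inter> T \<Longrightarrow>
      \<bar>g (fwd_jump T t) - g r - E * (fwd_jump T t - r)\<bar> \<le> \<epsilon>/2 * \<bar>fwd_jump T t - r\<bar>"
    using assms(2) e unfolding has_delta_deriv_def by (meson half_gt_zero)
  show "\<exists>U. open U \<and> t \<in> U \<and> (\<forall>r\<in>U \<inter> T.
      \<bar>c * f (fwd_jump T t) + g (fwd_jump T t) - (c * f r + g r) - (c * D + E) * (fwd_jump T t - r)\<bar>
        \<le> \<epsilon> * \<bar>fwd_jump T t - r\<bar>)"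
  proof (intro exI[of _ "U \<inter> V"] conjI ballI)
    fix r assume r: "r \<in> U \<inter> V \<inter> T"
    let ?h = "fwd_jump T t - r"
    let ?a = "f (fwd_jump T t) - f r - D * ?h" and ?b = "g (fwd_jump T t) - g r - E * ?h"
    have "\<bar>c * f (fwd_jump T t) + g (fwd_jump T t) - (c * f r + g r) - (c * D + E) * ?h\<bar> = \<bar>c * ?a + ?b\<bar>"
      by (simp add: algebra_simps)
    also have "\<dots> \<le> \<bar>c\<bar> * \<bar>?a\<bar> + \<bar>?b\<bar>"
      by (metis abs_mult abs_triangle_ineq)
    also have "\<dots> \<le> \<bar>c\<bar> * (e1 * \<bar>?h\<bar>) + \<epsilon>/2 * \<bar>?h\<bar>"
      using U(3)[of r] V(3)[of r] r by (intro add_mono mult_left_mono) auto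
    also have "\<dots> \<le> \<epsilon> / 2 * \<bar>?h\<bar> + \<epsilon>/2 * \<bar>?h\<bar>"
      using mult_right_mono[OF e1(2), of "\<bar>?h\<bar>"] by (simp add: mult.assoc)
    finally show "\<bar>c * f (fwd_jump T t) + g (fwd_jump T t) - (c * f r + g r) - (c * D + E) * ?h\<bar> \<le> \<epsilon> * \<bar>?h\<bar>"
      by simp
  qed (use U V in auto)
qed

lemma has_delta_deriv_continuous:
  assumes "has_delta_deriv T f D t" "t \<in> T"
  shows "continuous (at t within T) f"
proof -
  let ?s = "fwd_jump T t"
  have "\<forall>\<^sub>F r in at t within T. \<bar>f r - f t\<bar> < e" if e: "e > 0" for e
  proof -
    define e1 where "e1 = e / (2 * (2 * \<bar>?s - t\<bar> + 1))"
    have e1: "e1 > 0" "e1 * (2 * \<bar>?s - t\<bar> + 1) = e / 2"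
    proof -
      have "2 * \<bar>?s - t\<bar> + 1 > 0" by (intro add_nonneg_pos) simp_all
      then show "e1 > 0" "e1 * (2 * \<bar>?s - t\<bar> + 1) = e / 2"
        using e unfolding e1_def by (auto simp: divide_simps)
    qed
    obtain U where U: "open U" "t \<in> U" "\<And>r. r \<in> U \<inter> T \<Longrightarrow>
        \<bar>f ?s - f r - D * (?s - r)\<bar> \<le> e1 * \<bar>?s - r\<bar>"
      using assms(1) e1 unfolding has_delta_deriv_def by meson
    obtain d where d: "d > 0" "ball t d \<subseteq> U" using U openE by blast
    define d1 where "d1 = min (min d 1) (e / (2 * (\<bar>D\<bar> + 1)))"
    have d1: "d1 > 0" "d1 \<le> d" "d1 \<le> 1" "d1 * (\<bar>D\<bar> + 1) \<le> e / 2"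
    proof -
      have D: "\<bar>D\<bar> + 1 > 0" by (intro add_nonneg_pos) simp_all
      have le: "d1 \<le> e / (2 * (\<bar>D\<bar> + 1))" by (simp add: d1_def)
      have "e / (2 * (\<bar>D\<bar> + 1)) * (\<bar>D\<bar> + 1) = e / 2" using D by (auto simp: divide_simps)
      then show "d1 * (\<bar>D\<bar> + 1) \<le> e / 2" using mult_right_mono[OF le less_imp_le[OF D]] by linarith
      show "d1 > 0" "d1 \<le> d" "d1 \<le> 1" using d(1) e D by (auto simp: d1_def)
    qed
    have "\<bar>f r - f t\<bar> < e" if r: "r \<in> T" "\<bar>r - t\<bar> < d1" for r
    proof -
      have rU: "r \<in> U" using r d d1 by (auto simp: dist_real_def subset_eq)
      \<comment> \<open>The defining estimate compares only with the value at \<open>?s\<close>, so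
        it is used twice, at \<open>t\<close> and at \<open>r\<close>, and the value at
        \<open>?s\<close> cancels.\<close>
      have "f r - f t = (f ?s - f t - D * (?s - t)) - (f ?s - f r - D * (?s - r)) + D * (r - t)"
        by (simp add: algebra_simps)
      then have "\<bar>f r - f t\<bar> \<le> \<bar>f ?s - f t - D * (?s - t)\<bar> + \<bar>f ?s - f r - D * (?s - r)\<bar> + \<bar>D\<bar> * \<bar>r - t\<bar>"
        by (simp add: abs_mult[symmetric])
      also have "\<dots> \<le> e1 * \<bar>?s - t\<bar> + e1 * \<bar>?s - r\<bar> + \<bar>D\<bar> * \<bar>r - t\<bar>"
        using U(3)[of t] U(3)[of r] rU r U(2) assms(2) by simp
      also have "\<dots> \<le> e1 * (2 * \<bar>?s - t\<bar> + 1) + \<bar>D\<bar> * \<bar>r - t\<bar>"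
      proof -
        have "\<bar>?s - r\<bar> \<le> \<bar>?s - t\<bar> + 1" using r d1 by linarith
        then show ?thesis using mult_left_mono[of "\<bar>?s - r\<bar>" "\<bar>?s - t\<bar> + 1" e1] e1(1)
          by (simp add: algebra_simps)
      qed
      also have "\<bar>D\<bar> * \<bar>r - t\<bar> \<le> \<bar>D\<bar> * d1"
        using r by (intro mult_left_mono) auto
      also have "e1 * (2 * \<bar>?s - t\<bar> + 1) + \<bar>D\<bar> * d1 < e"
        using e1 d1 by (simp add: algebra_simps)
      finally show ?thesis by simp
    qed
    then show ?thesis
      unfolding eventually_at dist_real_def using d1(1) by blast
  qed
  then show ?thesis
    unfolding continuous_within tendsto_iff dist_real_def by blast
qed

text \<open>The points \<open>y\<close> at which \<open>f\<close> has lost at most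
  \<open>\<epsilon> * (y - a)\<close> form a closed set, and \<open>step\<close> pushes its supremum
  further unless that is \<open>b\<close>. Since \<open>step\<close> asks for a single later point,
  right-scattered and right-dense points need no separate treatment here.\<close>

lemma time_scale_mono:
  assumes T: "closed T" and ab: "a \<in> T" "b \<in> T" "a \<le> b"
    and cont: "continuous_on (T \<inter> {a..b}) f"
    and step: "\<And>t \<epsilon>. t \<in> T \<Longrightarrow> a \<le> t \<Longrightarrow> t < b \<Longrightarrow> \<epsilon> > 0 \<Longrightarrow> \<exists>y \<in> T. t < y \<and> y \<le> b \<and> f t - f y \<le> \<epsilon> * (y - t)"
  shows "f a \<le> (f b :: real)"
proof (rule field_le_epsilon)
  fix e :: real assume e: "e > 0"
  define \<epsilon> where "\<epsilon> = e / (b - a + 1)"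
  have eps: "\<epsilon> > 0" using e ab by (simp add: \<epsilon>_def)
  define S where "S = (T \<inter> {a..b}) \<inter> {y. f a - f y \<le> \<epsilon> * (y - a)}"
  have "S = (T \<inter> {a..b}) \<inter> (\<lambda>y. f a - f y - \<epsilon> * (y - a)) -` {..0}"
    by (auto simp: S_def)
  moreover have "closed \<dots>"
    using T by (intro continuous_closed_preimage continuous_intros cont) auto
  ultimately have "closed S" by simp
  have ne: "S \<noteq> {}" using ab by (auto simp: S_def)
  have bdd: "bdd_above S" by (rule bdd_aboveI[of _ b]) (auto simp: S_def)
  define c where "c = Sup S"
  have c: "c \<in> S" unfolding c_def by (rule closed_contains_Sup) fact+
  have "c = b"
  proof (rule ccontr)
    assume "c \<noteq> b"
    then have "c < b" "c \<in> T" "a \<le> c" using c by (auto simp: S_def)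
    then obtain y where y: "y \<in> T" "c < y" "y \<le> b" "f c - f y \<le> \<epsilon> * (y - c)" using step eps by blast
    have "f a - f y \<le> \<epsilon> * (c - a) + \<epsilon> * (y - c)" using y c by (simp add: S_def)
    then have "y \<in> S" using y \<open>a \<le> c\<close> by (simp add: S_def algebra_simps)
    then have "y \<le> c" unfolding c_def using bdd by (rule cSup_upper)
    then show False using y by simp
  qed
  then have "f a - f b \<le> \<epsilon> * (b - a)" using c by (simp add: S_def)
  also have "\<dots> \<le> e" using e ab by (simp add: \<epsilon>_def field_simps)
  finally show "f a \<le> f b + e" by simp
qed

text \<open>At a right-scattered point the jump itself serves, by the derivative estimate at
  \<open>r = t\<close>; at a right-dense point any sufficiently near later point of \<open>T\<close>
  does.\<close>

lemma has_delta_deriv_step: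
  assumes T: "closed T" and t: "t \<in> T" "b \<in> T" "t < b"
    and d: "has_delta_deriv T f D t" "D \<ge> 0" and e: "\<epsilon> > 0"
  shows "\<exists>y \<in> T. t < y \<and> y \<le> b \<and> f t - f y \<le> \<epsilon> * (y - t)"
proof -
  let ?s = "fwd_jump T t"
  obtain U where U: "open U" "t \<in> U" "\<And>r. r \<in> U \<inter> T \<Longrightarrow>
        \<bar>f ?s - f r - D * (?s - r)\<bar> \<le> \<epsilon> * \<bar>?s - r\<bar>"
    using d e unfolding has_delta_deriv_def by meson
  show ?thesis
  proof (cases "?s = t")
    case False
    then have "?s > t" using fwd_jump_ge[of t T] by simp
    moreover have "?s \<in> T" "?s \<le> b" using fwd_jump_in[OF T t(1)] fwd_jump_le[OF t(2,3)] by auto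
    moreover have "f t - f ?s \<le> \<epsilon> * (?s - t)"
    proof -
      have "D * (?s - t) \<ge> 0" using d(2) \<open>?s > t\<close> by simp
      then show ?thesis using U(3)[of t] U(2) t(1) \<open>?s > t\<close> by simp
    qed
    ultimately show ?thesis by blast
  next
    case True
    obtain d where d': "d > 0" "ball t d \<subseteq> U" using U openE by blast
    obtain y where y: "y \<in> T" "t < y" "y < min b (t + d)"
      using right_dense_point_between[OF True t(2,3), of "min b (t + d)"] t d' by auto
    then have "y \<in> U" using d' by (auto simp: dist_real_def subset_eq)
    then have "\<bar>f t - f y - D * (t - y)\<bar> \<le> \<epsilon> * (y - t)" using U(3)[of y] y True by simp
    moreover have "D * (t - y) \<le> 0" using d(2) y by (simp add: mult_nonneg_nonpos)
    ultimately show ?thesis using y by (intro bexI[of _ y]) auto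
  qed
qed

lemma has_delta_deriv_continuous_on:
  assumes "\<And>t. t \<in> T \<Longrightarrow> has_delta_deriv T f (f' t) t" "S \<subseteq> T"
  shows "continuous_on S f"
  by (rule continuous_on_subset[OF _ assms(2)])
    (auto simp: continuous_on_eq_continuous_within intro: has_delta_deriv_continuous[OF assms(1)])

lemma has_delta_deriv_mono:
  assumes T: "closed T" and ab: "a \<in> T" "b \<in> T" "a \<le> b"
    and d: "\<And>t. t \<in> T \<Longrightarrow> has_delta_deriv T f (f' t) t"
    and nonneg: "\<And>t. t \<in> T \<Longrightarrow> a \<le> t \<Longrightarrow> t < b \<Longrightarrow> 0 \<le> f' t"
  shows "f a \<le> f b"
proof (rule time_scale_mono[OF T ab])
  show "continuous_on (T \<inter> {a..b}) f" by (rule has_delta_deriv_continuous_on[OF d]) auto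
qed (use has_delta_deriv_step[OF T _ ab(2) _ d] nonneg in blast)

section \<open>Antiderivatives of rd-continuous functions\<close>

text \<open>Around each point such a function is \<open>e\<close>-close to one constant on the left
  and another on the right; a division fine for these neighbourhoods patches the constants into a
  uniform approximation. The number \<open>l\<close> may depend on \<open>e\<close>, so no limit has
  to be named.\<close>

lemma regulated_integrable_on:
  fixes f :: "real \<Rightarrow> real"
  assumes left: "\<And>x e. x \<in> {a..b} \<Longrightarrow> e > 0 \<Longrightarrow> \<exists>l. \<exists>d>0. \<forall>y\<in>{a..b}. x - d < y \<and> y < x \<longrightarrow> \<bar>f y - l\<bar> \<le> e"
    and right: "\<And>x e. x \<in> {a..b} \<Longrightarrow> e > 0 \<Longrightarrow> \<exists>l. \<exists>d>0. \<forall>y\<in>{a..b}. x < y \<and> y < x + d \<longrightarrow> \<bar>f y - l\<bar> \<le> e"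
  shows "f integrable_on {a..b}"
proof -
  have "\<exists>g. (\<forall>x\<in>cbox a b. norm (f x - g x) \<le> e) \<and> g integrable_on cbox a b" if e: "e > 0" for e
  proof -
    have "\<exists>l r d. x \<in> {a..b} \<longrightarrow> d > 0 \<and> (\<forall>y\<in>{a..b}. (x - d < y \<and> y < x \<longrightarrow> \<bar>f y - l\<bar> \<le> e) \<and>
        (x < y \<and> y < x + d \<longrightarrow> \<bar>f y - r\<bar> \<le> e))" for x
    proof (cases "x \<in> {a..b}")
      case True
      obtain l d where 1: "d > 0" "\<forall>y\<in>{a..b}. x - d < y \<and> y < x \<longrightarrow> \<bar>f y - l\<bar> \<le> e"
        using left[OF True e] by blast
      obtain r d' where 2: "d' > 0" "\<forall>y\<in>{a..b}. x < y \<and> y < x + d' \<longrightarrow> \<bar>f y - r\<bar> \<le> e"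
        using right[OF True e] by blast
      show ?thesis
        by (rule exI[of _ l], rule exI[of _ r], rule exI[of _ "min d d'"]) (use 1 2 in auto)
    qed auto
    then obtain l r d where lrd: "\<And>x. x \<in> {a..b} \<Longrightarrow> d x > 0 \<and> (\<forall>y\<in>{a..b}. (x - d x < y \<and> y < x \<longrightarrow> \<bar>f y - l x\<bar> \<le> e) \<and>
        (x < y \<and> y < x + d x \<longrightarrow> \<bar>f y - r x\<bar> \<le> e))"
      by metis
    have "gauge (\<lambda>x. if x \<in> {a..b} then ball x (d x) else UNIV)"
      using lrd by (auto simp: gauge_def)
    then obtain p where p: "p tagged_division_of cbox a b" "(\<lambda>x. if x \<in> {a..b} then ball x (d x) else UNIV) fine p"
      using fine_division_exists by blast
    have "\<exists>g. (\<forall>y\<in>K. norm (f y - g y) \<le> e) \<and> g integrable_on K" if K: "K \<in> snd ` p" for K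
    proof -
      obtain x where xK: "(x, K) \<in> p" using K by auto
      obtain u v where uv: "K = {u..v}" "x \<in> {u..v}" "{u..v} \<subseteq> {a..b}"
        using tagged_division_ofD(2-4)[OF p(1) xK] by auto
      have x: "x \<in> {a..b}" using uv by auto
      have sub: "{u..v} \<subseteq> ball x (d x)" using p(2) xK uv(1) x by (force simp: fine_def)
      define g where "g y = (if y < x then l x else if y = x then f x else r x)" for y
      have "norm (f y - g y) \<le> e" if "y \<in> K" for y
      proof -
        have "y \<in> {a..b}" "\<bar>y - x\<bar> < d x" using that uv sub by (auto simp: subset_eq dist_real_def abs_minus_commute)
        then show ?thesis using lrd[OF x] e by (auto simp: g_def)
      qed
      moreover have "g integrable_on {u..v}"
      proof (rule Henstock_Kurzweil_Integration.integrable_combine)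
        show "g integrable_on {u..x}"
          by (rule integrable_spike_finite[of "{x}" _ _ "\<lambda>_. l x"]) (auto simp: g_def)
        show "g integrable_on {x..v}"
          by (rule integrable_spike_finite[of "{x}" _ _ "\<lambda>_. r x"]) (auto simp: g_def)
      qed (use uv in auto)
      ultimately show ?thesis using uv by blast
    qed
    then show ?thesis
      using approximable_on_division[OF less_imp_le[OF e] division_of_tagged_division[OF p(1)], of f] by blast
  qed
  then show ?thesis
    using integrable_uniform_limit[of a b f] by simp
qed

text \<open>For closed \<open>S\<close> with points up to \<open>u\<close> this is the last of them.
  Unlike \<open>bwd_jump\<close> it fixes every point of \<open>S\<close>.\<close>

definition prev_point :: "real set \<Rightarrow> real \<Rightarrow> real" where
  "prev_point S u = Sup (S \<inter> {..u})"

lemma prev_point: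
  assumes "closed S" "c \<in> S" "c \<le> u"
  shows "prev_point S u \<in> S" "prev_point S u \<le> u" "c \<le> prev_point S u"
proof -
  have *: "S \<inter> {..u} \<noteq> {}" "bdd_above (S \<inter> {..u})" "closed (S \<inter> {..u})"
    using assms by (auto intro!: bdd_aboveI[of _ u])
  show "prev_point S u \<in> S" "prev_point S u \<le> u"
    using closed_contains_Sup[OF *] by (auto simp: prev_point_def)
  show "c \<le> prev_point S u"
    unfolding prev_point_def using assms * by (intro cSup_upper) auto
qed

lemma prev_point_eqI:
  assumes "closed S" "c \<in> S" "c \<le> u" "S \<inter> {c<..u} = {}"
  shows "prev_point S u = c"
  using prev_point[OF assms(1-3)] assms(4) by fastforce

section \<open>One-sided behaviour of rd-continuous functions and of their step extensions\<close>

lemma rd_continuous_left_limit: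
  assumes rd: "rd_continuous_on T (T \<inter> {a..b}) f" and t: "t \<in> T" "a \<le> t" "t \<le> b"
    and acc: "\<And>c. c < t \<Longrightarrow> \<exists>y\<in>T. c < y \<and> y < t" and e: "e > (0::real)"
  shows "\<exists>l. \<exists>d>0. \<forall>y\<in>T \<inter> {a..b}. t - d < y \<and> y < t \<longrightarrow> \<bar>f y - l\<bar> < e"
proof -
  have "T \<inter> {..<t} \<noteq> {}" using acc[of "t - 1"] by auto
  moreover have "Sup (T \<inter> {..<t}) = t"
    using acc by (intro cSup_eq_non_empty) (use calculation in \<open>auto, meson leD not_le_imp_less\<close>)
  ultimately have "left_dense T t" by (simp add: left_dense_def bwd_jump_def)
  then obtain l where "(f \<longlongrightarrow> l) (at t within (T \<inter> {a..b} \<inter> {..<t}))"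
    using rd t unfolding rd_continuous_on_def by auto
  then have "\<forall>\<^sub>F y in at t within (T \<inter> {a..b} \<inter> {..<t}). \<bar>f y - l\<bar> < e"
    using e by (simp add: tendsto_iff dist_real_def)
  then obtain d where "d > 0" "\<forall>y\<in>T \<inter> {a..b} \<inter> {..<t}. y \<noteq> t \<and> \<bar>y - t\<bar> < d \<longrightarrow> \<bar>f y - l\<bar> < e"
    by (auto simp: eventually_at dist_real_def)
  then show ?thesis by (intro exI[of _ l] exI[of _ d]) auto
qed

lemma rd_continuous_right_dense:
  assumes rd: "rd_continuous_on T I f" and t: "t \<in> I" "fwd_jump T t = t" and e: "e > (0::real)"
  shows "\<exists>d>0. \<forall>y\<in>I. \<bar>y - t\<bar> < d \<longrightarrow> \<bar>f y - f t\<bar> < e"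
proof -
  have "continuous (at t within I) f"
    using rd t unfolding rd_continuous_on_def right_dense_def graininess_def by simp
  then show ?thesis
    unfolding continuous_within_eps_delta using e by (auto simp: dist_real_def)
qed

lemma rd_continuous_on_subset_interval:
  assumes "rd_continuous_on T (T \<inter> {a..}) f" 
  shows "rd_continuous_on T (T \<inter> {a..b}) f"
  unfolding rd_continuous_on_def
proof (intro ballI conjI impI)
  fix t assume t: "t \<in> T \<inter> {a..b}"
  { assume "right_dense T t"
    then have "continuous (at t within (T \<inter> {a..})) f"
      using assms t unfolding rd_continuous_on_def by auto
    then show "continuous (at t within (T \<inter> {a..b})) f"
      by (rule continuous_within_subset) auto }
  { assume "left_dense T t"
    then obtain l where "(f \<longlongrightarrow> l) (at t within (T \<inter> {a..} \<inter> {..<t}))"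
      using assms t unfolding rd_continuous_on_def by auto
    moreover have "T \<inter> {a..} \<inter> {..<t} = T \<inter> {a..b} \<inter> {..<t}" using t by auto
    ultimately show "\<exists>l. (f \<longlongrightarrow> l) (at t within (T \<inter> {a..b} \<inter> {..<t}))" by auto }
qed

text \<open>Here \<open>u\<close> is any real number, as the step extension demands. If no gap
  starts at \<open>u\<close>, points of \<open>T\<close> accumulate there from the right, and
  closedness puts \<open>u\<close> into \<open>T\<close>.\<close>

lemma right_scattered_or_dense:
  assumes T: "closed T" and u: "c0 \<in> T" "u < c0"
  obtains c where "u < c" "T \<inter> {u<..<c} = {}" | "u \<in> T" "fwd_jump T u = u"
proof (cases "\<exists>c>u. T \<inter> {u<..<c} = {}")
  case False
  have "u \<in> closure T"
    unfolding closure_approachable dist_real_def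
  proof (intro allI impI)
    fix e :: real assume "e > 0"
    then obtain y where "y \<in> T" "u < y" "y < u + e" using False[simplified, rule_format, of "u + e"] by auto
    then show "\<exists>y\<in>T. \<bar>y - u\<bar> < e" by (intro bexI[of _ y]) auto
  qed
  then have "u \<in> T" using T by (simp add: closure_closed)
  moreover have "fwd_jump T u = u"
  proof (rule ccontr)
    assume "fwd_jump T u \<noteq> u"
    then have gt: "fwd_jump T u > u" using fwd_jump_ge[of u T] by simp
    then obtain y where "y \<in> T" "u < y" "y < fwd_jump T u" using False by fastforce
    then show False using fwd_jump_le[of y T u] by simp
  qed
  ultimately show ?thesis using that by blast
qed (use that in blast)

lemma left_accumulation_in:
  assumes T: "closed T" and acc: "\<And>c. c < u \<Longrightarrow> \<exists>y\<in>T. c < y \<and> y < u"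
  shows "u \<in> (T :: real set)"
proof -
  have "u \<in> closure T"
    unfolding closure_approachable dist_real_def
  proof (intro allI impI)
    fix e :: real assume "e > 0"
    then obtain y where "y \<in> T" "u - e < y" "y < u" using acc[of "u - e"] by auto
    then show "\<exists>y\<in>T. \<bar>y - u\<bar> < e" by (intro bexI[of _ y]) auto
  qed
  then show ?thesis using T by (simp add: closure_closed)
qed

text \<open>Next to a gap the extension is constant; where points of \<open>T\<close> accumulate it
  inherits the left limit or the right continuity of \<open>f\<close>.\<close>

lemma prev_point_integrable:
  assumes T: "closed T" "a \<in> T" "\<not> bdd_above T" and rd: "rd_continuous_on T (T \<inter> {a..}) f"
  shows "(\<lambda>u. f (prev_point (T \<inter> {a..}) u)) integrable_on {a..b}"
proof (rule regulated_integrable_on)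
  let ?S = "T \<inter> {a..}"
  have S: "closed ?S" using T by auto
  fix x e :: real assume x: "x \<in> {a..b}" and e: "e > 0"
  show "\<exists>l. \<exists>d>0. \<forall>y\<in>{a..b}. x - d < y \<and> y < x \<longrightarrow> \<bar>f (prev_point ?S y) - l\<bar> \<le> e"
  proof (cases "\<exists>c<x. T \<inter> {c<..<x} = {}")
    case True
    then obtain c where c: "c < x" "T \<inter> {c<..<x} = {}" by blast
    have "prev_point ?S y = prev_point ?S (max a c)" if "y \<in> {a..b}" "c < y" "y < x" for y
    proof -
      have "?S \<inter> {..y} = ?S \<inter> {..max a c}"
        using c(2) that by (auto simp: disjoint_iff not_less le_max_iff_disj)
      then show ?thesis by (simp add: prev_point_def)
    qed
    then show ?thesis using c e by (intro exI[of _ "f (prev_point ?S (max a c))"] exI[of _ "x - c"]) auto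
  next
    case False
    then have acc: "\<And>c. c < x \<Longrightarrow> \<exists>y\<in>T. c < y \<and> y < x" by fastforce
    have xT: "x \<in> T" using left_accumulation_in[OF T(1) acc] .
    obtain l d where ld: "d > 0" "\<And>y. y\<in>T \<inter> {a..x} \<Longrightarrow> x - d < y \<Longrightarrow> y < x \<Longrightarrow> \<bar>f y - l\<bar> < e"
      using rd_continuous_left_limit[OF rd_continuous_on_subset_interval[OF rd, of x] xT _ _ acc e] x
      by (metis atLeastAtMost_iff order_refl)
    show ?thesis
    proof (cases "x = a")
      case False
      \<comment> \<open>Because \<open>c\<close> is a point of \<open>T\<close>, the last point up
        to any \<open>y\<close> after \<open>c\<close> cannot drop below \<open>c\<close>, so it
        stays within \<open>d\<close> of \<open>x\<close>.\<close>
      obtain c where c: "c \<in> T" "max a (x - d) < c" "c < x" using acc[of "max a (x - d)"] False x ld(1) by auto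
      have "\<bar>f (prev_point ?S y) - l\<bar> \<le> e" if "c < y" "y < x" for y
        using prev_point[OF S, of c y] ld(2)[of "prev_point ?S y"] c that by auto
      then show ?thesis using c by (intro exI[of _ l] exI[of _ "x - c"]) auto
    qed (intro exI[of _ 0] exI[of _ 1], auto)
  qed
  obtain c0 where c0: "c0 \<in> T" "x < c0" using T(3) by (meson bdd_above.I not_le)
  show "\<exists>l. \<exists>d>0. \<forall>y\<in>{a..b}. x < y \<and> y < x + d \<longrightarrow> \<bar>f (prev_point ?S y) - l\<bar> \<le> e"
    using T(1) c0
  proof (cases rule: right_scattered_or_dense)
    case (1 c)
    have "prev_point ?S y = prev_point ?S x" if "x < y" "y < c" for y
    proof -
      have "?S \<inter> {..y} = ?S \<inter> {..x}"
        using 1 that by (auto simp: disjoint_iff not_less)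
      then show ?thesis by (simp add: prev_point_def)
    qed
    then show ?thesis using 1 e by (intro exI[of _ "f (prev_point ?S x)"] exI[of _ "c - x"]) auto
  next
    case 2
    then obtain d where d: "d > 0" "\<And>y. y\<in>?S \<Longrightarrow> \<bar>y - x\<bar> < d \<Longrightarrow> \<bar>f y - f x\<bar> < e"
      using rd_continuous_right_dense[OF rd, of x, OF _ _ e] x by auto
    have "\<bar>f (prev_point ?S y) - f x\<bar> \<le> e" if "x < y" "y < x + d" for y
      using prev_point[OF S, of x y] d(2)[of "prev_point ?S y"] 2 that x by auto
    then show ?thesis using d by (intro exI[of _ "f x"] exI[of _ d]) auto
  qed
qed

text \<open>The antiderivative is the integral of the step extension \<open>f \<circ> prev_point\<close>, which is constant across
  the gaps of \<open>T\<close> and hence contributes \<open>\<mu>(t) f(t)\<close> at a right-scattered \<open>t\<close>.\<close>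

lemma delta_antideriv_exists:
  assumes T: "closed T" "a \<in> T" "\<not> bdd_above T" and rd: "rd_continuous_on T (T \<inter> {a..}) f"
  shows "\<exists>F. \<forall>t\<in>T \<inter> {a..}. has_delta_deriv (T \<inter> {a..}) F (f t) t"
proof -
  let ?S = "T \<inter> {a..}"
  define g where "g u = f (prev_point ?S u)" for u
  define F where "F t = integral {a..t} g" for t
  have S: "closed ?S" using T by auto
  have int: "g integrable_on {c..b}" if "a \<le> c" for c b
    using integrable_subinterval_real[OF prev_point_integrable[OF T rd, of b], of c b] that
    by (auto simp: g_def[abs_def])
  have diff: "F d - F c = integral {c..d} g" if "a \<le> c" "c \<le> d" for c d
    using Henstock_Kurzweil_Integration.integral_combine[OF that int] that by (simp add: F_def)
  \<comment> \<open>The hypothesis stops short of \<open>d\<close>, since at the end of a gap the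
    extension already takes the value of the next point; one point does not affect the
    integral.\<close>
  have bound: "\<bar>F d - F c - k * (d - c)\<bar> \<le> e * (d - c)"
    if "a \<le> c" "c \<le> d" "e \<ge> 0" "\<And>u. c \<le> u \<Longrightarrow> u < d \<Longrightarrow> \<bar>g u - k\<bar> \<le> e" for c d k e
  proof -
    have "(\<lambda>u. if u = d then k else g u) integrable_on {c..d}"
      by (rule integrable_spike_finite[of "{d}" _ _ g]) (use int that in auto)
    then have i: "((\<lambda>u. (if u = d then k else g u) - k) has_integral (F d - F c - k * (d - c))) {c..d}"
    proof -
      have "((\<lambda>u. if u = d then k else g u) has_integral (F d - F c)) {c..d}"
        unfolding diff[OF that(1,2)]
        by (rule has_integral_spike_finite[of "{d}" _ _ g]) (use int that in \<open>auto intro: integrable_integral\<close>)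
      from has_integral_diff[OF this has_integral_const_real[of k c d]] show ?thesis
        using that by (simp add: mult.commute)
    qed
    show ?thesis
      using has_integral_bound_real[OF that(3) finite.emptyI i] that by auto
  qed
  have "has_delta_deriv ?S F (f t) t" if t: "t \<in> ?S" for t
    unfolding has_delta_deriv_def
  proof (intro allI impI)
    fix \<epsilon> :: real assume e: "\<epsilon> > 0"
    let ?s = "fwd_jump ?S t"
    have sT: "?s = fwd_jump T t" using t by (simp add: fwd_jump_restrict)
    have sS: "?s \<in> ?S" using fwd_jump_in[OF S t] .
    show "\<exists>U. open U \<and> t \<in> U \<and> (\<forall>r\<in>U \<inter> ?S. \<bar>F ?s - F r - f t * (?s - r)\<bar> \<le> \<epsilon> * \<bar>?s - r\<bar>)"
    proof (cases "?s = t")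
      case True
      then obtain d where d: "d > 0" "\<And>y. y\<in>?S \<Longrightarrow> \<bar>y - t\<bar> < d \<Longrightarrow> \<bar>f y - f t\<bar> < \<epsilon>"
        using rd_continuous_right_dense[OF rd t _ e] sT by metis
      \<comment> \<open>As \<open>r\<close> belongs to \<open>?S\<close>, the last point up to
        \<open>u\<close> lies between \<open>r\<close> and \<open>u\<close>, hence within
        \<open>d\<close> of \<open>t\<close>.\<close>
      have gd: "\<bar>g u - f t\<bar> \<le> \<epsilon>" if "r \<in> ?S" "r \<le> u" "t - d < r" "u < t + d" for u r
        using d(2)[of "prev_point ?S u"] prev_point[OF S that(1,2)] that unfolding g_def
        by (auto simp: abs_less_iff)
      have "\<bar>F t - F r - f t * (t - r)\<bar> \<le> \<epsilon> * \<bar>t - r\<bar>" if r: "r \<in> ?S" "\<bar>t - r\<bar> < d" for r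
      proof (cases "r \<le> t")
        case True
        then show ?thesis using bound[of r t \<epsilon> "f t"] gd[of r] r e d(1) by auto
      next
        case False
        have "\<bar>F r - F t - f t * (r - t)\<bar> \<le> \<epsilon> * (r - t)"
          using bound[of t r \<epsilon> "f t"] gd[of t] t r e d(1) False by auto
        moreover have "F t - F r - f t * (t - r) = - (F r - F t - f t * (r - t))" by (simp add: algebra_simps)
        ultimately show ?thesis using False by (simp only: abs_minus_cancel) simp
      qed
      then show ?thesis using True d by (intro exI[of _ "ball t d"]) (auto simp: dist_real_def)
    next
      case False
      then have gt: "?s > t" using fwd_jump_ge[of t ?S] by simp
      have "g u = f t" if "t \<le> u" "u < ?s" for u
      proof -
        have "?S \<inter> {t<..u} = {}" using fwd_jump_le[of _ ?S t] that by fastforce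
        then show ?thesis using prev_point_eqI[OF S t that(1)] by (simp add: g_def)
      qed
      then have jump: "F ?s - F t = f t * (?s - t)"
        using bound[of t ?s 0 "f t"] t gt by auto
      \<comment> \<open>For \<open>r\<close> near \<open>t\<close> the factor
        \<open>\<bar>?s - r\<bar>\<close> stays above half the jump, so continuity at
        \<open>t\<close> together with the exact formula \<open>jump\<close> suffices.\<close>
      have "continuous_on {a..?s} F"
        unfolding F_def by (intro indefinite_integral_continuous_1 int) simp
      then have "continuous (at t within {a..?s}) (\<lambda>r. F r - f t * r)"
        using t gt by (auto simp: continuous_on_eq_continuous_within intro!: continuous_intros)
      then obtain d where d: "d > 0" "\<And>r. r \<in> {a..?s} \<Longrightarrow> \<bar>r - t\<bar> < d \<Longrightarrow>
          \<bar>(F r - f t * r) - (F t - f t * t)\<bar> < \<epsilon> * ((?s - t) / 2)"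
        unfolding continuous_within_eps_delta dist_real_def using e gt
        by (metis diff_gt_0_iff_gt half_gt_zero mult_pos_pos)
      have "\<bar>F ?s - F r - f t * (?s - r)\<bar> \<le> \<epsilon> * \<bar>?s - r\<bar>"
        if r: "r \<in> ?S" "\<bar>t - r\<bar> < min d ((?s - t) / 2)" for r
      proof -
        have h: "(?s - t) / 2 \<le> \<bar>?s - r\<bar>" "r \<in> {a..?s}" using r gt by (auto simp: min_def abs_if split: if_splits)
        have "F ?s - F r - f t * (?s - r) = - ((F r - f t * r) - (F t - f t * t))"
          using jump by (simp add: algebra_simps)
        then have "\<bar>F ?s - F r - f t * (?s - r)\<bar> < \<epsilon> * ((?s - t) / 2)"
          using d(2)[OF h(2)] r(2) by (simp only: abs_minus_cancel abs_minus_commute[of r t] min_less_iff_conj)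
        also have "\<dots> \<le> \<epsilon> * \<bar>?s - r\<bar>" using h(1) e by simp
        finally show ?thesis by simp
      qed
      then show ?thesis using d gt
        by (intro exI[of _ "ball t (min d ((?s - t) / 2))"]) (auto simp: dist_real_def)
    qed
  qed
  then show ?thesis by blast
qed

lemma delta_antideriv:
  assumes "closed T" "a \<in> T" "\<not> bdd_above T" "rd_continuous_on T (T \<inter> {a..}) f" "t \<in> T \<inter> {a..}"
  shows "has_delta_deriv (T \<inter> {a..}) (delta_antideriv (T \<inter> {a..}) f) (f t) t"
proof -
  have "\<forall>t\<in>T \<inter> {a..}. has_delta_deriv (T \<inter> {a..}) (delta_antideriv (T \<inter> {a..}) f) (f t) t"
    unfolding delta_antideriv_def by (rule someI_ex[OF delta_antideriv_exists[OF assms(1-4)]])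
  then show ?thesis using assms(5) by (rule bspec)
qed

text \<open>Rd-continuity gives boundedness near each point, separately on either side, and
  compactness leaves finitely many local bounds. Applied to \<open>\<alpha>\<close> and to initial
  functions.\<close>

lemma rd_continuous_on_bounded:
  assumes T: "closed T" and rd: "rd_continuous_on T (T \<inter> {a..b}) f"
  shows "\<exists>M. \<forall>t \<in> T \<inter> {a..b}. \<bar>f t\<bar> \<le> M"
proof -
  let ?I = "T \<inter> {a..b}"
  have "\<exists>d>0. \<exists>M. \<forall>y\<in>?I. \<bar>y - t\<bar> < d \<longrightarrow> \<bar>f y\<bar> \<le> M" if t: "t \<in> ?I" for t
  proof -
    have right: "\<exists>d>0. \<exists>M. \<forall>y\<in>?I. t \<le> y \<and> y < t + d \<longrightarrow> \<bar>f y\<bar> \<le> M"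
    proof (cases "fwd_jump T t = t")
      case True
      obtain d where "d > 0" "\<forall>y\<in>?I. \<bar>y - t\<bar> < d \<longrightarrow> \<bar>f y - f t\<bar> < 1"
        using rd_continuous_right_dense[OF rd t True, of 1] by auto
      then show ?thesis by (intro exI[of _ d] conjI exI[of _ "\<bar>f t\<bar> + 1"]) force+
    next
      case False
      then have "fwd_jump T t > t" using fwd_jump_ge[of t T] by simp
      then show ?thesis
        by (intro exI[of _ "fwd_jump T t - t"] conjI exI[of _ "\<bar>f t\<bar>"]) (use fwd_jump_le[of _ T t] in force)+
    qed
    have left: "\<exists>d>0. \<exists>M. \<forall>y\<in>?I. y < t \<and> t - d < y \<longrightarrow> \<bar>f y\<bar> \<le> M"
    proof (cases "\<exists>c<t. \<forall>y\<in>T. \<not> (c < y \<and> y < t)")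
      case True
      then obtain c where "c < t" "\<forall>y\<in>T. \<not> (c < y \<and> y < t)" by blast
      then show ?thesis by (intro exI[of _ "t - c"]) auto
    next
      case False
      then obtain l d where "d > 0" "\<forall>y\<in>?I. t - d < y \<and> y < t \<longrightarrow> \<bar>f y - l\<bar> < 1"
        using rd_continuous_left_limit[OF rd, of t 1] t by auto
      then show ?thesis by (intro exI[of _ d] conjI exI[of _ "\<bar>l\<bar> + 1"]) force+
    qed
    obtain d1 M1 where 1: "d1 > 0" "\<And>y. y\<in>?I \<Longrightarrow> t \<le> y \<Longrightarrow> y < t + d1 \<Longrightarrow> \<bar>f y\<bar> \<le> M1" using right by blast
    obtain d2 M2 where 2: "d2 > 0" "\<And>y. y\<in>?I \<Longrightarrow> y < t \<Longrightarrow> t - d2 < y \<Longrightarrow> \<bar>f y\<bar> \<le> M2" using left by blast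
    have "\<bar>f y\<bar> \<le> max M1 M2" if "y \<in> ?I" "\<bar>y - t\<bar> < min d1 d2" for y
      using 1(2)[of y] 2(2)[of y] that by (cases "t \<le> y") (auto simp: abs_if le_max_iff_disj split: if_splits)
    then show ?thesis using 1 2 by (intro exI[of _ "min d1 d2"] conjI exI[of _ "max M1 M2"]) auto
  qed
  then obtain d M where dM: "\<And>t. t \<in> ?I \<Longrightarrow> d t > 0 \<and> (\<forall>y\<in>?I. \<bar>y - t\<bar> < d t \<longrightarrow> \<bar>f y\<bar> \<le> M t)"
    by metis
  have "compact ?I" using T by (simp add: closed_Int_compact)
  then obtain C where C: "C \<subseteq> ?I" "finite C" "?I \<subseteq> (\<Union>t\<in>C. ball t (d t))"
    by (rule compactE_image[where C = ?I and f = "\<lambda>t. ball t (d t)"]) (use dM in auto)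
  have "\<bar>f y\<bar> \<le> (\<Sum>t\<in>C. \<bar>M t\<bar>)" if y: "y \<in> ?I" for y
  proof -
    obtain t where t: "t \<in> C" "\<bar>y - t\<bar> < d t" using C y by (fastforce simp: dist_real_def)
    then have "t \<in> ?I" using C(1) by blast
    then have "\<bar>f y\<bar> \<le> M t" using dM y t(2) by blast
    then have "\<bar>f y\<bar> \<le> \<bar>M t\<bar>" by linarith
    also have "\<dots> \<le> (\<Sum>t\<in>C. \<bar>M t\<bar>)" using t C by (intro member_le_sum) auto
    finally show ?thesis .
  qed
  then show ?thesis by blast
qed

section \<open>The delay equation\<close>

text \<open>\<open>mass\<close> bounds increments of \<open>F\<close> from any admissible
  \<open>c\<close> at or after \<open>\<alpha> r\<close>, which spares the infimum in
  \<open>lower_delay\<close> and the clipping at \<open>t0\<close>. With \<open>r\<close> the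
  forward jump of \<open>c\<close> it bounds the jumps of \<open>F\<close>, thanks to
  \<open>\<alpha>_jump\<close>.\<close>

locale delay_equation =
  fixes T :: "real set" and t0 :: real and A \<alpha> F :: "real \<Rightarrow> real" and \<kappa> :: real
  assumes closed: "closed T" and unbounded: "\<not> bdd_above T" and t0: "t0 \<in> T"
    and A_nonneg: "\<And>t. t \<in> T \<Longrightarrow> t0 \<le> t \<Longrightarrow> 0 \<le> A t"
    and \<alpha>_in: "\<And>t. t \<in> T \<Longrightarrow> t0 \<le> t \<Longrightarrow> \<alpha> t \<in> T"
    and \<alpha>_le: "\<And>t. t \<in> T \<Longrightarrow> t0 \<le> t \<Longrightarrow> \<alpha> t \<le> t"
    and \<alpha>_jump: "\<And>t. t \<in> T \<Longrightarrow> t0 \<le> t \<Longrightarrow> \<alpha> (fwd_jump T t) \<le> t"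
    and \<alpha>_lim: "\<And>c. \<exists>v. \<forall>t \<in> T. v \<le> t \<longrightarrow> c \<le> \<alpha> t"
    and F: "\<And>t. t \<in> T \<Longrightarrow> t0 \<le> t \<Longrightarrow> has_delta_deriv (T \<inter> {t0..}) F (A t) t"
    and F_lim: "\<And>c. \<exists>v. \<forall>t \<in> T. v \<le> t \<longrightarrow> c \<le> F t"
    and mass: "\<And>r c. r \<in> T \<Longrightarrow> t0 \<le> r \<Longrightarrow> c \<in> T \<Longrightarrow> t0 \<le> c \<Longrightarrow> \<alpha> r \<le> c \<Longrightarrow> F r - F c \<le> \<kappa>"
    and \<kappa>: "0 < \<kappa>" "\<kappa> < 1"
begin

text \<open>Values before \<open>s\<close> enter only through \<open>x (\<alpha> t)\<close>, so the
  initial function appears below as a hypothesis on delayed values.\<close>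

definition solves :: "real \<Rightarrow> (real \<Rightarrow> real) \<Rightarrow> bool" where
  "solves s x \<longleftrightarrow> t0 \<le> s \<and> (\<forall>t \<in> T. s \<le> t \<longrightarrow> has_delta_deriv (T \<inter> {s..}) x (- (A t * x (\<alpha> t))) t)"

section \<open>Comparison of a solution with the antiderivative \<open>F\<close>\<close>

lemma F_mono: "a \<in> T \<Longrightarrow> b \<in> T \<Longrightarrow> t0 \<le> a \<Longrightarrow> a \<le> b \<Longrightarrow> F a \<le> F b"
  by (rule has_delta_deriv_mono[where T = "T \<inter> {t0..}" and f' = A]) (use closed F A_nonneg in auto)

lemma point_above: "\<exists>t \<in> T. c < t"
  using unbounded by (meson bdd_above.I not_le)

lemma solves_uminus: "solves s x \<Longrightarrow> solves s (\<lambda>t. - x t)"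
  unfolding solves_def has_delta_deriv_def
  by (auto simp: abs_minus_commute minus_mult_left[symmetric] algebra_simps)

lemma solves_later: "solves s x \<Longrightarrow> s \<le> s' \<Longrightarrow> solves s' x"
  unfolding solves_def by (auto intro: has_delta_deriv_restrict)

lemma solves_continuous_on: "solves s x \<Longrightarrow> s \<le> a \<Longrightarrow> continuous_on (T \<inter> {a..b}) x"
  by (rule has_delta_deriv_continuous_on[where T = "T \<inter> {s..}"]) (auto simp: solves_def)

lemma F_continuous_on: "t0 \<le> a \<Longrightarrow> continuous_on (T \<inter> {a..b}) F"
  by (rule has_delta_deriv_continuous_on[where T = "T \<inter> {t0..}"]) (use F in auto)

text \<open>The derivative is \<open>A t\<close> times \<open>c + x (\<alpha> t)\<close>, hence
  nonnegative as soon as the delayed value is at least \<open>- c\<close>. The constant may be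
  chosen afresh at every point.\<close>

lemma has_delta_deriv_combination:
  assumes "solves s x" "t \<in> T" "s \<le> t"
  shows "has_delta_deriv (T \<inter> {s..}) (\<lambda>r. c * F r + - x r) (c * A t + A t * x (\<alpha> t)) t"
proof (rule has_delta_deriv_cmult_add)
  show "has_delta_deriv (T \<inter> {s..}) F (A t) t"
    by (rule has_delta_deriv_restrict[OF F]) (use assms in \<open>auto simp: solves_def\<close>)
  show "has_delta_deriv (T \<inter> {s..}) (\<lambda>r. - x r) (A t * x (\<alpha> t)) t"
    using solves_uminus[OF assms(1)] assms by (auto simp: solves_def)
qed

text \<open>The derivative of \<open>- m * F - x\<close> is \<open>A\<close> times the excess of the
  delayed value over \<open>m\<close>, so this function is nondecreasing.\<close>

lemma solves_diff_le:
  assumes x: "solves s x" and ab: "a \<in> T" "b \<in> T" "s \<le> a" "a \<le> b"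
    and m: "\<And>r. r \<in> T \<Longrightarrow> a \<le> r \<Longrightarrow> r < b \<Longrightarrow> m \<le> x (\<alpha> r)"
  shows "x b - x a \<le> - m * (F b - F a)"
proof -
  have "- m * F a + - x a \<le> - m * F b + - x b"
  proof (rule has_delta_deriv_mono[where T = "T \<inter> {s..}" and f = "\<lambda>r. - m * F r + - x r"])
    show "has_delta_deriv (T \<inter> {s..}) (\<lambda>r. - m * F r + - x r) (- m * A t + A t * x (\<alpha> t)) t"
      if "t \<in> T \<inter> {s..}" for t
      using has_delta_deriv_combination[OF x, of t "- m"] that by simp
    show "0 \<le> - m * A t + A t * x (\<alpha> t)" if "t \<in> T \<inter> {s..}" "a \<le> t" "t < b" for t
      using mult_left_mono[OF m[of t], of "A t"] A_nonneg[of t] that x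
      by (auto simp: solves_def mult.commute)
  qed (use closed ab in auto)
  then show ?thesis by (simp add: algebra_simps)
qed

lemma solves_abs_diff_le:
  assumes x: "solves s x" and ab: "a \<in> T" "b \<in> T" "s \<le> a" "a \<le> b"
    and N: "\<And>r. r \<in> T \<Longrightarrow> a \<le> r \<Longrightarrow> r < b \<Longrightarrow> \<bar>x (\<alpha> r)\<bar> \<le> N"
  shows "\<bar>x b - x a\<bar> \<le> N * (F b - F a)"
  using solves_diff_le[OF x ab, of "- N"] solves_diff_le[OF solves_uminus[OF x] ab, of "- N"] N
  by (force simp: abs_le_iff)

section \<open>Maxima of solutions and a priori bounds\<close>

lemma first_maximum:
  assumes "continuous_on (T \<inter> {v..t}) x" "v \<in> T" "t \<in> T" "v \<le> t"
  shows "\<exists>c \<in> T. v \<le> c \<and> c \<le> t \<and> x t \<le> (x c :: real) \<and> (\<forall>r \<in> T. v \<le> r \<and> r < c \<longrightarrow> x r < x c)"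
proof -
  have K: "compact (T \<inter> {v..t})" using closed by (simp add: closed_Int_compact)
  obtain p where p: "p \<in> T \<inter> {v..t}" "\<And>y. y \<in> T \<inter> {v..t} \<Longrightarrow> x y \<le> x p"
    using continuous_attains_sup[OF K _ assms(1)] assms by (metis (no_types) IntI atLeastAtMost_iff empty_iff order_refl)
  \<comment> \<open>The set of all maximisers; its least element has strictly smaller values before
    it, as \<open>strict_maximum_le\<close> requires.\<close>
  define S where "S = (T \<inter> {v..t}) \<inter> x -` {x p..}"
  have "closed S" unfolding S_def
    using closed by (intro continuous_closed_preimage assms) auto
  moreover have "S \<noteq> {}" "bdd_below S" using p by (auto simp: S_def intro!: bdd_belowI[of _ v])
  ultimately have c: "Inf S \<in> S" and low: "\<And>r. r \<in> S \<Longrightarrow> Inf S \<le> r"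
    by (auto intro: closed_contains_Inf cInf_lower)
  have "x r < x (Inf S)" if "r \<in> T" "v \<le> r" "r < Inf S" for r
  proof (rule ccontr)
    assume "\<not> ?thesis"
    then have "r \<in> S" using that c by (auto simp: S_def)
    then show False using low that by force
  qed
  then show ?thesis using c p(2)[of t] assms by (intro bexI[of _ "Inf S"]) (auto simp: S_def)
qed

text \<open>With \<open>Q\<close> the maximal ratio of \<open>\<bar>x\<bar>\<close> to \<open>G = exp (F - F s)\<close>, the function \<open>Q G \<mp> x\<close> is
  nondecreasing, as \<open>e\<^sup>z \<ge> 1 + z\<close>; where the maximum is attained it vanishes, which forces \<open>Q \<le> N\<close>.\<close>

lemma exponential_bound:
  assumes x: "solves s x" and s: "s \<in> T" and t: "t \<in> T" "s \<le> t"
    and \<alpha>: "\<And>r. r \<in> T \<Longrightarrow> s \<le> r \<Longrightarrow> \<alpha> r < s \<Longrightarrow> \<bar>x (\<alpha> r)\<bar> \<le> N" and xs: "\<bar>x s\<bar> \<le> N"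
  shows "\<bar>x t\<bar> \<le> N * exp (F t - F s)"
proof -
  define G where "G r = exp (F r - F s)" for r
  have st0: "t0 \<le> s" using x by (simp add: solves_def)
  have G: "G r > 0" for r by (simp add: G_def)
  have G1: "1 \<le> G r" if "r \<in> T" "s \<le> r" for r using F_mono[OF s that(1) st0 that(2)] by (simp add: G_def)
  have Gm: "G q \<le> G r" if "q \<in> T" "s \<le> q" "r \<in> T" "q \<le> r" for q r
    using F_mono[OF that(1,3) _ that(4)] that st0 by (simp add: G_def)
  let ?I = "T \<inter> {s..t}"
  have Gc: "continuous_on ?I G" unfolding G_def by (intro continuous_intros F_continuous_on st0)
  have K: "compact ?I" using closed by (simp add: closed_Int_compact)
  have "continuous_on ?I (\<lambda>r. \<bar>x r\<bar> / G r)"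
    using G by (intro continuous_intros solves_continuous_on[OF x] Gc order_refl) (auto simp: less_imp_neq[symmetric])
  then obtain p where p: "p \<in> ?I" "\<And>y. y \<in> ?I \<Longrightarrow> \<bar>x y\<bar> / G y \<le> \<bar>x p\<bar> / G p"
    using continuous_attains_sup[OF K, of "\<lambda>r. \<bar>x r\<bar> / G r"] s t by fastforce
  define Q where "Q = \<bar>x p\<bar> / G p"
  have Q: "\<bar>x r\<bar> \<le> Q * G r" if "r \<in> ?I" for r using p(2)[OF that] G[of r] by (simp add: Q_def pos_divide_le_eq)
  have Qp: "\<bar>x p\<bar> = Q * G p" using G[of p] by (simp add: Q_def)
  have "Q \<le> N"
  proof (rule ccontr)
    assume "\<not> Q \<le> N"
    then have QN: "N < Q" by simp
    have Q0: "0 \<le> Q" using QN xs by linarith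
    have \<alpha>Q: "\<bar>x (\<alpha> r)\<bar> \<le> Q * G r" if r: "r \<in> ?I" for r
    proof (cases "\<alpha> r < s")
      case True
      then have "\<bar>x (\<alpha> r)\<bar> \<le> N" using \<alpha> r by auto
      also have "\<dots> \<le> Q * G r" using mult_left_mono[OF G1[of r] Q0] r QN by auto
      finally show ?thesis .
    next
      case False
      have "\<alpha> r \<in> T" "\<alpha> r \<le> r" using \<alpha>_in[of r] \<alpha>_le[of r] r st0 by auto
      then have "\<bar>x (\<alpha> r)\<bar> \<le> Q * G (\<alpha> r)" using Q r False by auto
      also have "\<dots> \<le> Q * G r" using Gm[of "\<alpha> r" r] \<open>\<alpha> r \<in> T\<close> \<open>\<alpha> r \<le> r\<close> False r Q0 by (auto intro: mult_left_mono)
      finally show ?thesis .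
    qed
    \<comment> \<open>Stated for a separate \<open>y\<close> so as to serve both \<open>x\<close>
      and \<open>- x\<close>, according to the sign at \<open>p\<close>.\<close>
    have main: False if y: "solves s y" "y p = Q * G p" "y s \<le> N" "\<And>r. r \<in> ?I \<Longrightarrow> - (Q * G r) \<le> y (\<alpha> r)" for y
    proof -
      have "Q * G s - y s \<le> Q * G p - y p"
      proof (rule time_scale_mono[OF closed s, of p])
        show "continuous_on (T \<inter> {s..p}) (\<lambda>r. Q * G r - y r)"
          unfolding G_def by (intro continuous_intros F_continuous_on solves_continuous_on[OF y(1)] st0 order_refl)
        fix r \<epsilon> :: real assume r: "r \<in> T" "s \<le> r" "r < p" and e: "\<epsilon> > 0"
        \<comment> \<open>The factor \<open>Q * G r\<close> is frozen at \<open>r\<close>, so that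
          only the derivative of \<open>F\<close> is needed and no chain rule for \<open>G\<close>;
          the inequality for the exponential then replaces the linear term by
          \<open>G q\<close>.\<close>
        have "0 \<le> Q * G r * A r + A r * y (\<alpha> r)"
          using mult_left_mono[OF y(4)[of r], of "A r"] A_nonneg[of r] r p st0 by (auto simp: mult_ac)
        then obtain q where q: "q \<in> T" "r < q" "q \<le> p"
            "(Q * G r * F r + - y r) - (Q * G r * F q + - y q) \<le> \<epsilon> * (q - r)"
          using has_delta_deriv_step[OF _ _ _ _ has_delta_deriv_combination[OF y(1), of r "Q * G r"], of p \<epsilon>]
            closed r p e by auto
        have "G r * (1 + (F q - F r)) \<le> G r * exp (F q - F r)"
          using G[of r] exp_ge_add_one_self[of "F q - F r"] by (intro mult_left_mono) auto
        also have "\<dots> = G q" by (simp add: G_def exp_add[symmetric])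
        finally have "Q * (G r * (1 + (F q - F r))) \<le> Q * G q" using Q0 by (rule mult_left_mono)
        then have "(Q * G r - y r) - (Q * G q - y q) \<le> \<epsilon> * (q - r)" using q(4) by (simp add: algebra_simps)
        then show "\<exists>q \<in> T. r < q \<and> q \<le> p \<and> (Q * G r - y r) - (Q * G q - y q) \<le> \<epsilon> * (q - r)" using q by blast
      qed (use p in auto)
      moreover have "G s = 1" by (simp add: G_def)
      ultimately show False using y QN by simp
    qed
    show False
    proof (cases "x p \<ge> 0")
      case True
      then show False using main[OF x] Qp xs \<alpha>Q by (force simp: abs_le_iff)
    next
      case False
      then show False using main[OF solves_uminus[OF x]] Qp xs \<alpha>Q by (force simp: abs_le_iff)
    qed
  qed
  have "\<bar>x t\<bar> \<le> Q * G t" using Q t by auto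
  also have "\<dots> \<le> N * G t" using \<open>Q \<le> N\<close> G[of t] by simp
  finally show ?thesis by (simp add: G_def)
qed

text \<open>Delayed values are bounded from \<open>s\<close> on and not merely from
  \<open>v\<close>, because the last nonpositive point may lie before \<open>v\<close>. The proof
  splits by whether \<open>t\<close> has an immediate predecessor: only then can a final jump carry
  the increase of \<open>F\<close> since that point past \<open>\<kappa>\<close>.\<close>

lemma strict_maximum_le:
  assumes x: "solves s x" and s: "s \<in> T" and v: "v \<in> T" "s \<le> v" "v < t" and t: "t \<in> T"
    and \<alpha>s: "\<And>r. r \<in> T \<Longrightarrow> v \<le> r \<Longrightarrow> r < t \<Longrightarrow> s \<le> \<alpha> r"
    and N: "\<And>r. r \<in> T \<Longrightarrow> s \<le> r \<Longrightarrow> r < t \<Longrightarrow> \<bar>x (\<alpha> r)\<bar> \<le> N" and N0: "0 \<le> N"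
    and max: "\<And>r. r \<in> T \<Longrightarrow> v \<le> r \<Longrightarrow> r < t \<Longrightarrow> x r < x t" and pos: "0 < x t"
  shows "x t \<le> \<kappa> * N"
proof -
  have st0: "t0 \<le> s" using x by (simp add: solves_def)
  \<comment> \<open>If \<open>x (\<alpha> r)\<close> were nonnegative throughout
    \<open>[q, t)\<close>, then \<open>x\<close> could not grow from \<open>q\<close> to
    \<open>t\<close>, against \<open>max\<close>.\<close>
  have neg: "\<exists>r \<in> T. q \<le> r \<and> r < t \<and> x (\<alpha> r) < 0" if q: "q \<in> T" "v \<le> q" "q < t" for q
  proof (rule ccontr)
    assume "\<not> ?thesis"
    then have "x t - x q \<le> - 0 * (F t - F q)"
      using v q t by (intro solves_diff_le[OF x]) (auto simp: not_less)
    then show False using max[OF q] by simp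
  qed
  \<comment> \<open>For each \<open>r\<close> supplied by \<open>neg\<close> the point
    \<open>\<alpha> r\<close> belongs to \<open>Z\<close>, so it precedes or equals the last point
    \<open>\<xi>\<close> of \<open>Z\<close>, and
    \<open>F r - F \<xi> \<le> \<kappa>\<close>.\<close>
  define Z where "Z = (T \<inter> {s..t}) \<inter> x -` {..0}"
  have "closed Z" unfolding Z_def using closed
    by (intro continuous_closed_preimage solves_continuous_on[OF x]) auto
  have \<alpha>Z: "\<alpha> r \<in> Z" "F r - F (\<alpha> r) \<le> \<kappa>" if "r \<in> T" "v \<le> r" "r < t" "x (\<alpha> r) < 0" for r
    using \<alpha>_in[of r] \<alpha>_le[of r] \<alpha>s[of r] mass[of r "\<alpha> r"] that v st0 by (auto simp: Z_def)
  then have "Z \<noteq> {}" using neg[OF v(1) _ v(3)] by auto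
  moreover have bdd: "bdd_above Z" by (rule bdd_aboveI[of _ t]) (auto simp: Z_def)
  ultimately have "Sup Z \<in> Z" using \<open>closed Z\<close> by (intro closed_contains_Sup)
  then obtain \<xi> where \<xi>: "\<xi> \<in> T" "s \<le> \<xi>" "\<xi> \<le> t" "x \<xi> \<le> 0" and last: "\<And>r. r \<in> Z \<Longrightarrow> r \<le> \<xi>"
    using cSup_upper[OF _ bdd] by (auto simp: Z_def)
  have \<xi>t: "\<xi> < t" using \<xi> pos by (cases "\<xi> = t") auto
  have lip: "\<bar>x b - x a\<bar> \<le> N * (F b - F a)" if "a \<in> T" "b \<in> T" "s \<le> a" "a \<le> b" "b \<le> t" for a b
    by (rule solves_abs_diff_le[OF x that(1-4)]) (use N that in auto)
  show ?thesis
  proof (cases "\<exists>q\<in>T. q < t \<and> T \<inter> {q<..<t} = {}")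
    case True
    then obtain q where q: "q \<in> T" "q < t" "T \<inter> {q<..<t} = {}" by blast
    have upq: "r \<le> q" if "r \<in> T" "r < t" for r using q that by fastforce
    have vq: "v \<le> q" using upq v by auto
    obtain r where r: "r \<in> T" "q \<le> r" "r < t" "x (\<alpha> r) < 0" using neg[OF q(1) vq q(2)] by blast
    have rq: "r = q" using upq[OF r(1,3)] r by simp
    define \<zeta> where "\<zeta> = \<alpha> q"
    have \<zeta>: "\<zeta> \<in> Z" "F q - F \<zeta> \<le> \<kappa>" "x \<zeta> < 0" using \<alpha>Z[of q] r rq vq unfolding \<zeta>_def by auto
    then have \<zeta>': "\<zeta> \<in> T" "s \<le> \<zeta>" "\<zeta> \<le> \<xi>" using last by (auto simp: Z_def)
    define p where "p = F t - F q"
    have p0: "0 \<le> p" using F_mono[OF q(1) t] vq v st0 q by (simp add: p_def)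
    have "fwd_jump T q = t" using fwd_jump_eqI[OF t q(2,3)] .
    \<comment> \<open>The delay at \<open>t\<close> reaches back at least to \<open>q\<close>, so
      \<open>mass\<close> with \<open>r = t\<close> and \<open>c = q\<close> bounds the last
      jump.\<close>
    then have "\<alpha> t \<le> q" using \<alpha>_jump[of q] q vq v st0 by auto
    then have "p \<le> \<kappa>" using mass[of t q] t q vq v st0 by (auto simp: p_def)
    then have p1: "p \<le> 1" using \<kappa> by simp
    \<comment> \<open>\<open>F t - F \<xi>\<close> may exceed \<open>\<kappa>\<close> here. The last jump is absorbed by writing
      \<open>x \<xi> - p x \<zeta> = (1 - p) x \<xi> + p (x \<xi> - x \<zeta>)\<close> with \<open>x \<xi> \<le> 0\<close>.\<close>
    have "x t - x q \<le> - x \<zeta> * p" unfolding p_def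
    proof (rule solves_diff_le[OF x])
      show "x \<zeta> \<le> x (\<alpha> r)" if "r \<in> T" "q \<le> r" "r < t" for r
        using upq[of r] that by (simp add: \<zeta>_def)
    qed (use q t vq v in auto)
    moreover have "x q - x \<xi> \<le> N * (F q - F \<xi>)" using lip[of \<xi> q] \<xi> q upq[OF \<xi>(1) \<xi>t] by auto
    moreover have "x \<xi> - x \<zeta> \<le> N * (F \<xi> - F \<zeta>)" using lip[of \<zeta> \<xi>] \<xi> \<zeta>' by auto
    then have "p * (x \<xi> - x \<zeta>) \<le> p * (N * (F \<xi> - F \<zeta>))" using p0 by (rule mult_left_mono)
    moreover have "(1 - p) * x \<xi> \<le> 0" using p1 \<xi> by (simp add: mult_nonneg_nonpos)
    moreover have "p * (N * (F \<xi> - F \<zeta>)) \<le> 1 * (N * (F \<xi> - F \<zeta>))"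
      using p1 N0 F_mono[of \<zeta> \<xi>] \<zeta>' \<xi> st0 by (intro mult_right_mono) auto
    moreover have "N * (F q - F \<zeta>) \<le> N * \<kappa>" using \<zeta>(2) N0 by (rule mult_left_mono)
    ultimately show ?thesis by (simp add: algebra_simps)
  next
    case False
    have acc: "\<exists>y\<in>T. c < y \<and> y < t" if "v \<le> c" "c < t" for c
    proof (rule ccontr)
      assume n: "\<not> ?thesis"
      \<comment> \<open>Were \<open>(c, t)\<close> free of points of \<open>T\<close>, the last
        point up to \<open>c\<close> would start a gap ending at \<open>t\<close>.\<close>
      note prev = prev_point[OF closed v(1) that(1)]
      have "T \<inter> {prev_point T c<..<t} = {}"
      proof (rule ccontr)
        assume "T \<inter> {prev_point T c<..<t} \<noteq> {}"
        then obtain y where y: "y \<in> T" "prev_point T c < y" "y < t" by auto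
        then have "y \<le> c" using n by force
        then show False using prev_point(3)[OF closed y(1), of c] y by simp
      qed
      then show False using False prev that by auto
    qed
    have "F t - F \<xi> \<le> \<kappa>"
    proof (rule field_le_epsilon)
      fix e :: real assume "e > 0"
      \<comment> \<open>The bound by \<open>\<kappa>\<close> is available only at points
        \<open>r\<close> before \<open>t\<close>; continuity of \<open>F\<close> carries it to
        \<open>t\<close> up to \<open>e\<close>.\<close>
      have "continuous (at t within T \<inter> {s..t}) F"
        using F_continuous_on[OF st0, of t] t v by (auto simp: continuous_on_eq_continuous_within)
      then obtain d where d: "d > 0" "\<And>y. y \<in> T \<inter> {s..t} \<Longrightarrow> \<bar>y - t\<bar> < d \<Longrightarrow> \<bar>F y - F t\<bar> < e"
        using \<open>e > 0\<close> unfolding continuous_within_eps_delta dist_real_def by blast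
      obtain y where y: "y \<in> T" "max v (t - d) < y" "y < t"
        using acc[of "max v (t - d)"] v d(1) by auto
      then obtain r where r: "r \<in> T" "y \<le> r" "r < t" "x (\<alpha> r) < 0" using neg[of y] by auto
      have rv: "v \<le> r" using y r by simp
      have rd: "\<bar>r - t\<bar> < d" using y r by auto
      have "F (\<alpha> r) \<le> F \<xi>"
        using \<alpha>Z[OF r(1) rv r(3,4)] last[of "\<alpha> r"] F_mono[of "\<alpha> r" \<xi>] \<xi> st0 by (auto simp: Z_def)
      then have "F r - F \<xi> \<le> \<kappa>" using \<alpha>Z(2)[OF r(1) rv r(3,4)] by simp
      moreover have "\<bar>F r - F t\<bar> < e" using d(2)[OF _ rd] r rv v by auto
      ultimately show "F t - F \<xi> \<le> \<kappa> + e" by simp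
    qed
    then have "N * (F t - F \<xi>) \<le> N * \<kappa>" using N0 by (rule mult_left_mono)
    moreover have "x t - x \<xi> \<le> N * (F t - F \<xi>)" using lip[of \<xi> t] \<xi> t by auto
    ultimately show ?thesis using \<xi> by (simp add: mult.commute)
  qed
qed

text \<open>The earliest maximum over \<open>[v, t]\<close> has a value above
  \<open>\<kappa> * N\<close>, so by \<open>strict_maximum_le\<close> it cannot lie after
  \<open>v\<close>.\<close>

lemma antitone_above_threshold:
  assumes x: "solves s x" and s: "s \<in> T" and v: "v \<in> T" "s \<le> v" "v \<le> t" and t: "t \<in> T"
    and \<alpha>s: "\<And>r. r \<in> T \<Longrightarrow> v \<le> r \<Longrightarrow> r < t \<Longrightarrow> s \<le> \<alpha> r"
    and N: "\<And>r. r \<in> T \<Longrightarrow> s \<le> r \<Longrightarrow> r < t \<Longrightarrow> \<bar>x (\<alpha> r)\<bar> \<le> N" and N0: "0 \<le> N"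
    and gt: "\<kappa> * N < x t"
  shows "x t \<le> x v"
proof -
  obtain c where c: "c \<in> T" "v \<le> c" "c \<le> t" "x t \<le> x c" "\<And>r. r \<in> T \<Longrightarrow> v \<le> r \<Longrightarrow> r < c \<Longrightarrow> x r < x c"
    using first_maximum[OF solves_continuous_on[OF x v(2)] v(1) t v(3)] by blast
  have "0 \<le> \<kappa> * N" using \<kappa> N0 by simp
  then have "0 < x c" using gt c(4) by linarith
  have "c = v"
  proof (rule ccontr)
    assume "c \<noteq> v"
    then have "v < c" using c by simp
    have "x c \<le> \<kappa> * N"
      by (rule strict_maximum_le[OF x s v(1,2) \<open>v < c\<close> c(1) _ _ N0 c(5) \<open>0 < x c\<close>])
        (use \<alpha>s N c(3) in auto)
    then show False using gt c(4) by simp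
  qed
  then show ?thesis using c by simp
qed

text \<open>At an earliest maximum of \<open>\<bar>x\<bar>\<close> exceeding \<open>M\<close>, the
  value itself bounds all delayed values so far. As \<open>\<kappa> < 1\<close>, it lies above its
  own threshold, and \<open>antitone_above_threshold\<close> pushes it below the value at
  \<open>v\<close>.\<close>

lemma bounded_after:
  assumes x: "solves s x" and s: "s \<in> T" and v: "v \<in> T" "s \<le> v"
    and \<alpha>s: "\<And>r. r \<in> T \<Longrightarrow> v \<le> r \<Longrightarrow> s \<le> \<alpha> r"
    and M: "\<And>r. r \<in> T \<Longrightarrow> s \<le> r \<Longrightarrow> r \<le> v \<Longrightarrow> \<bar>x r\<bar> \<le> M"
    and M': "\<And>r. r \<in> T \<Longrightarrow> s \<le> r \<Longrightarrow> \<alpha> r < s \<Longrightarrow> \<bar>x (\<alpha> r)\<bar> \<le> M"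
    and t: "t \<in> T" "s \<le> t"
  shows "\<bar>x t\<bar> \<le> M"
proof (rule ccontr)
  assume n: "\<not> \<bar>x t\<bar> \<le> M"
  then have vt: "v < t" using M t by (meson not_le)
  have st0: "t0 \<le> s" using x by (simp add: solves_def)
  have M0: "0 \<le> M" using M[OF v(1,2)] by simp
  have "continuous_on (T \<inter> {v..t}) (\<lambda>r. \<bar>x r\<bar>)"
    by (intro continuous_intros solves_continuous_on[OF x v(2)])
  then obtain c where c: "c \<in> T" "v \<le> c" "c \<le> t" "\<bar>x t\<bar> \<le> \<bar>x c\<bar>" "\<And>r. r \<in> T \<Longrightarrow> v \<le> r \<Longrightarrow> r < c \<Longrightarrow> \<bar>x r\<bar> < \<bar>x c\<bar>"
    using first_maximum[of v t "\<lambda>r. \<bar>x r\<bar>"] v t vt by (meson less_imp_le)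
  have Mc: "M < \<bar>x c\<bar>" using n c(4) by simp
  have N: "\<bar>x (\<alpha> r)\<bar> \<le> \<bar>x c\<bar>" if r: "r \<in> T" "s \<le> r" "r < c" for r
  proof (cases "\<alpha> r < s")
    case True
    then show ?thesis using M' r Mc by (meson less_imp_le order_trans)
  next
    case False
    have "\<alpha> r \<in> T" "\<alpha> r \<le> r" using \<alpha>_in[of r] \<alpha>_le[of r] r st0 by auto
    then show ?thesis using c(5)[of "\<alpha> r"] M[of "\<alpha> r"] r False Mc by (cases "v \<le> \<alpha> r") auto
  qed
  have "0 < \<bar>x c\<bar>" using Mc M0 by (rule le_less_trans[rotated])
  then have \<kappa>c: "\<kappa> * \<bar>x c\<bar> < \<bar>x c\<bar>" using \<kappa>(2) by simp
  have "\<bar>x v\<bar> \<le> M" using M v by simp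
  show False
  proof (cases "x c \<ge> 0")
    case True
    then have "x c \<le> x v"
      using antitone_above_threshold[OF x s v c(2,1) \<alpha>s N] \<kappa>c by auto
    then show False using True Mc \<open>\<bar>x v\<bar> \<le> M\<close> by simp
  next
    case False
    then have "- x c \<le> - x v"
      using antitone_above_threshold[OF solves_uminus[OF x] s v c(2,1) \<alpha>s, where N = "\<bar>x c\<bar>"] N \<kappa>c
      by simp
    then show False using False Mc \<open>\<bar>x v\<bar> \<le> M\<close> by simp
  qed
qed

section \<open>Decay of bounded solutions\<close>

lemma eventually_contracts_above:
  assumes x: "solves s x" and s: "s \<in> T" and N0: "0 < N"
    and N: "\<And>r. r \<in> T \<Longrightarrow> s \<le> r \<Longrightarrow> \<bar>x r\<bar> \<le> N"
  shows "\<exists>v \<in> T. s \<le> v \<and> (\<forall>r \<in> T. v \<le> r \<longrightarrow> x r \<le> \<kappa> * N)"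
proof -
  have later: "\<exists>v \<in> T. c \<le> v \<and> (\<forall>r \<in> T. v \<le> r \<longrightarrow> c \<le> \<alpha> r)" for c
  proof -
    obtain w where w: "\<And>r. r \<in> T \<Longrightarrow> w \<le> r \<Longrightarrow> c \<le> \<alpha> r" using \<alpha>_lim by blast
    obtain v where "v \<in> T" "max c w < v" using point_above by blast
    then show ?thesis using w by (intro bexI[of _ v]) auto
  qed
  \<comment> \<open>Three delays are waited out: after \<open>s'\<close> delayed values obey
    \<open>N\<close>, after \<open>v\<close> delays stay in the range of the equation restarted at
    \<open>s'\<close>, and after \<open>u\<close> they stay where \<open>low\<close> holds.\<close>
  obtain s' where s': "s' \<in> T" "s \<le> s'" "\<And>r. r \<in> T \<Longrightarrow> s' \<le> r \<Longrightarrow> s \<le> \<alpha> r" using later[of s] by blast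
  obtain v where v: "v \<in> T" "s' \<le> v" "\<And>r. r \<in> T \<Longrightarrow> v \<le> r \<Longrightarrow> s' \<le> \<alpha> r" using later[of s'] by blast
  obtain u where u: "u \<in> T" "v \<le> u" "\<And>r. r \<in> T \<Longrightarrow> u \<le> r \<Longrightarrow> v \<le> \<alpha> r" using later[of v] by blast
  have st0: "t0 \<le> s" using x by (simp add: solves_def)
  have N': "\<bar>x (\<alpha> r)\<bar> \<le> N" if "r \<in> T" "s' \<le> r" for r
    using N[of "\<alpha> r"] s'(3)[of r] \<alpha>_in[of r] that st0 s' by auto
  show ?thesis
  proof (rule ccontr)
    assume n: "\<not> ?thesis"
    \<comment> \<open>Under the negation, values above \<open>\<kappa> * N\<close> recur beyond
      every \<open>w\<close>, and \<open>antitone_above_threshold\<close> carries one of them back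
      to \<open>w\<close>.\<close>
    have low: "\<kappa> * N \<le> x w" if w: "w \<in> T" "v \<le> w" for w
    proof -
      have "s \<le> w" using w v s' by simp
      then obtain t where t: "t \<in> T" "w \<le> t" "\<kappa> * N < x t" using n w by (meson not_le)
      have "x t \<le> x w"
        by (rule antitone_above_threshold[OF solves_later[OF x s'(2)] s'(1) w(1) _ t(2,1) _ N' _ t(3)])
          (use w v N0 in auto)
      then show ?thesis using t by simp
    qed
    have up: "x t \<le> x u - \<kappa> * N * (F t - F u)" if "t \<in> T" "u \<le> t" for t
    proof -
      have "x t - x u \<le> - (\<kappa> * N) * (F t - F u)"
        by (rule solves_diff_le[OF x u(1) that(1)])
          (use that u v s' st0 in \<open>auto intro!: low \<alpha>_in\<close>)
      then show ?thesis by simp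
    qed
    \<comment> \<open>At this level of \<open>F\<close> the upper bound \<open>up\<close> has fallen
      to zero, against \<open>low\<close>.\<close>
    obtain w where w: "\<And>t. t \<in> T \<Longrightarrow> w \<le> t \<Longrightarrow> F u + x u / (\<kappa> * N) \<le> F t" using F_lim by blast
    obtain t where t: "t \<in> T" "max u w < t" using point_above by blast
    have pos: "0 < \<kappa> * N" using \<kappa> N0 by simp
    have "\<kappa> * N * (x u / (\<kappa> * N)) \<le> \<kappa> * N * (F t - F u)"
      using w[of t] t pos by (intro mult_left_mono) auto
    moreover have "\<kappa> * N * (x u / (\<kappa> * N)) = x u"
      using pos by (simp only: times_divide_eq_right nonzero_mult_div_cancel_left less_imp_neq[symmetric] not_False_eq_True)
    ultimately have "x t \<le> 0" using up[of t] t by simp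
    moreover have "\<kappa> * N \<le> x t" using low[of t] t u by auto
    ultimately show False using pos by simp
  qed
qed

lemma eventually_small:
  assumes x: "solves s x" and s: "s \<in> T" and N0: "0 < N"
    and N: "\<And>r. r \<in> T \<Longrightarrow> s \<le> r \<Longrightarrow> \<bar>x r\<bar> \<le> N" and e: "0 < e"
  shows "\<exists>v. \<forall>r \<in> T. v \<le> r \<longrightarrow> \<bar>x r\<bar> < e"
proof -
  have iterate: "\<exists>v \<in> T. s \<le> v \<and> (\<forall>r \<in> T. v \<le> r \<longrightarrow> \<bar>x r\<bar> \<le> \<kappa> ^ n * N)" for n
  proof (induction n)
    case 0
    then show ?case using s N by auto
  next
    case (Suc n)
    then obtain v where v: "v \<in> T" "s \<le> v" "\<And>r. r \<in> T \<Longrightarrow> v \<le> r \<Longrightarrow> \<bar>x r\<bar> \<le> \<kappa> ^ n * N" by blast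
    have pos: "0 < \<kappa> ^ n * N" using \<kappa> N0 by simp
    have xv: "solves v x" by (rule solves_later[OF x v(2)])
    obtain v1 where v1: "v1 \<in> T" "v \<le> v1" "\<And>r. r \<in> T \<Longrightarrow> v1 \<le> r \<Longrightarrow> x r \<le> \<kappa> * (\<kappa> ^ n * N)"
      using eventually_contracts_above[OF xv v(1) pos v(3)] by blast
    obtain v2 where v2: "v2 \<in> T" "v \<le> v2" "\<And>r. r \<in> T \<Longrightarrow> v2 \<le> r \<Longrightarrow> - x r \<le> \<kappa> * (\<kappa> ^ n * N)"
      using eventually_contracts_above[OF solves_uminus[OF xv] v(1) pos] v(3) by (auto simp: Bex_def)
    have "max v1 v2 \<in> T" using v1 v2 by (simp add: max_def)
    moreover have "\<bar>x r\<bar> \<le> \<kappa> ^ Suc n * N" if "r \<in> T" "max v1 v2 \<le> r" for r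
      using v1(3)[of r] v2(3)[of r] that by (simp add: abs_le_iff mult.assoc)
    ultimately show ?case using v v1 by (intro bexI[of _ "max v1 v2"]) auto
  qed
  obtain n where "\<kappa> ^ n < e / N" using real_arch_pow_inv[of "e / N" \<kappa>] e N0 \<kappa> by auto
  then have "\<kappa> ^ n * N < e" using N0 by (simp add: pos_less_divide_eq)
  then show ?thesis using iterate[of n] by (meson le_less_trans)
qed

section \<open>A bound in terms of the initial data\<close>

lemma next_point_exists:
  assumes u: "u \<in> T" "t0 \<le> u"
  shows "\<exists>v \<in> T. u < v \<and> F v \<le> F u + 1"
proof (cases "fwd_jump T u = u")
  case False
  then have gt: "u < fwd_jump T u" using fwd_jump_ge[of u T] by simp
  then have "F (fwd_jump T u) - F u \<le> \<kappa>"
    using mass[of "fwd_jump T u" u] fwd_jump_in[OF closed u(1)] \<alpha>_jump[OF u] u by auto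
  then show ?thesis using gt fwd_jump_in[OF closed u(1)] \<kappa> by (intro bexI[of _ "fwd_jump T u"]) auto
next
  case True
  have "continuous (at u within T \<inter> {t0..}) F"
    using has_delta_deriv_continuous[OF F[OF u]] u by auto
  then obtain d where d: "d > 0" "\<And>y. y \<in> T \<inter> {t0..} \<Longrightarrow> \<bar>y - u\<bar> < d \<Longrightarrow> \<bar>F y - F u\<bar> < 1"
    unfolding continuous_within_eps_delta dist_real_def by (meson zero_less_one)
  obtain b where "b \<in> T" "u < b" using point_above by blast
  then obtain v where "v \<in> T" "u < v" "v < u + d"
    using right_dense_point_between[OF True, of b "u + d"] d by auto
  then show ?thesis using d(2)[of v] u by (intro bexI[of _ v]) auto
qed

text \<open>The exponential estimate covers the time up to a point \<open>v\<close> after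
  \<open>u\<close>, and \<open>bounded_after\<close> the rest. Delays are known to stay above
  \<open>s\<close> only strictly after \<open>u\<close>; the passage from \<open>u\<close> to
  \<open>v\<close> costs the \<open>+ 1\<close> in the exponent.\<close>

lemma solution_bound:
  assumes x: "solves s x" and s: "s \<in> T" and u: "u \<in> T" "s \<le> u" "F u - F s \<le> C"
    and \<alpha>s: "\<And>r. r \<in> T \<Longrightarrow> u < r \<Longrightarrow> s \<le> \<alpha> r"
    and N: "\<And>r. r \<in> T \<Longrightarrow> s \<le> r \<Longrightarrow> \<alpha> r < s \<Longrightarrow> \<bar>x (\<alpha> r)\<bar> \<le> N" and xs: "\<bar>x s\<bar> \<le> N"
    and t: "t \<in> T" "s \<le> t"
  shows "\<bar>x t\<bar> \<le> N * exp (C + 1)"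
proof -
  have st0: "t0 \<le> s" using x by (simp add: solves_def)
  have N0: "0 \<le> N" using xs by linarith
  obtain v where v: "v \<in> T" "u < v" "F v \<le> F u + 1" using next_point_exists[OF u(1)] st0 u(2) by auto
  have "F s \<le> F u" by (rule F_mono[OF s u(1) st0 u(2)])
  then have C1: "1 \<le> exp (C + 1)" using u(3) by simp
  show ?thesis
  proof (rule bounded_after[OF x s v(1) _ _ _ _ t])
    fix r assume r: "r \<in> T" "s \<le> r" "r \<le> v"
    have "\<bar>x r\<bar> \<le> N * exp (F r - F s)" by (rule exponential_bound[OF x s r(1,2) N xs])
    also have "\<dots> \<le> N * exp (C + 1)"
      using F_mono[of r v] r v u(3) st0 N0 by (intro mult_left_mono) auto
    finally show "\<bar>x r\<bar> \<le> N * exp (C + 1)" .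
  next
    fix r assume "r \<in> T" "s \<le> r" "\<alpha> r < s"
    then have "\<bar>x (\<alpha> r)\<bar> \<le> N" by (rule N)
    also have "\<dots> \<le> N * exp (C + 1)" using mult_left_mono[OF C1 N0] by simp
    finally show "\<bar>x (\<alpha> r)\<bar> \<le> N * exp (C + 1)" .
  qed (use v u \<alpha>s in auto)
qed

end

section \<open>Stability\<close>

lemma eventually_at_top_in:
  "eventually P (at_top_in T) \<longleftrightarrow> (\<exists>v. \<forall>t \<in> T. v \<le> t \<longrightarrow> P t)"
  unfolding at_top_in_def eventually_inf_principal eventually_at_top_linorder by auto

lemma filterlim_at_top_in:
  fixes f :: "real \<Rightarrow> real"
  assumes "filterlim f at_top (at_top_in T)"
  shows "\<exists>v. \<forall>t \<in> T. v \<le> t \<longrightarrow> c \<le> f t"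
  using assms unfolding filterlim_at_top eventually_at_top_in by blast

text \<open>A real number strictly in between is a uniform bound that still stays below
  \<open>c\<close>; applied with \<open>c\<close> equal to \<open>\<infinity>\<close> and to
  \<open>1\<close>.\<close>

lemma SUP_ereal_less:
  assumes "(SUP s \<in> S. ereal (f s)) < c"
  shows "\<exists>b. ereal b < c \<and> (\<forall>s \<in> S. f s \<le> b)"
proof -
  obtain b where b: "(SUP s \<in> S. ereal (f s)) < ereal b" "ereal b < c" using ereal_dense2[OF assms] by blast
  have "f s \<le> b" if "s \<in> S" for s
    using SUP_upper[OF that, of "\<lambda>s. ereal (f s)"] b(1) by (metis ereal_less_eq(3) less_imp_le order_trans)
  then show ?thesis using b by blast
qed

text \<open>As \<open>A\<close> is given only from \<open>t0\<close> on, integrals live in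
  \<open>T \<inter> {t0..}\<close> and the lower limit is clipped at \<open>t0\<close>. The
  condition on \<open>\<alpha> (fwd_jump T t)\<close> says nothing directly at a left-dense
  right-scattered point, which is no forward jump; \<open>delay\<close> covers such points.\<close>

theorem theorem4p5:
  fixes T :: "real set" and t0 :: real and A \<alpha> :: "real \<Rightarrow> real"
  assumes "time_scale T" and "\<not> bdd_above T" and "t0 \<in> T"
    and "\<forall>t \<in> T \<inter> {t0..}. 0 \<le> A t"
    and "rd_continuous_on T (T \<inter> {t0..}) A"
    and "\<forall>t \<in> T \<inter> {t0..}. \<alpha> t \<in> T"
    and "rd_continuous_on T (T \<inter> {t0..}) \<alpha>"
    and "filterlim \<alpha> at_top (at_top_in T)"
    and delay: "\<forall>t \<in> T \<inter> {t0..}. \<alpha> t \<le> t"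
    and "\<forall>t \<in> T \<inter> {t0..}. \<alpha> (fwd_jump T t) \<le> t"
    and "(SUP s \<in> T \<inter> {t0..}.
            ereal (delta_integral (T \<inter> {t0..}) A s (delay_inverse T t0 \<alpha> s))) < \<infinity>"
    and "filterlim (\<lambda>t. delta_integral (T \<inter> {t0..}) A t0 t) at_top (at_top_in T)"
    and "(SUP t \<in> T \<inter> {t0..}.
            ereal (delta_integral (T \<inter> {t0..}) A (max t0 (lower_delay T \<alpha> t)) t)) < 1"
  shows "globally_asymptotically_stable T t0 A \<alpha>"
proof -
  have T: "closed T" using assms(1) by (simp add: time_scale_def)
  note unbounded = assms(2) and t0 = assms(3)
  let ?S = "T \<inter> {t0..}"
  have A_nonneg: "0 \<le> A t" if "t \<in> T" "t0 \<le> t" for t using assms(4) that by auto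
  have \<alpha>_in: "\<alpha> t \<in> T" if "t \<in> T" "t0 \<le> t" for t using assms(6) that by auto
  define F where "F = delta_antideriv ?S A"
  have F: "has_delta_deriv ?S F (A t) t" if "t \<in> T" "t0 \<le> t" for t
    unfolding F_def using delta_antideriv[OF T t0 unbounded assms(5)] that by auto
  have F_mono: "F a \<le> F b" if "a \<in> T" "b \<in> T" "t0 \<le> a" "a \<le> b" for a b
    by (rule has_delta_deriv_mono[where T = ?S and f' = A]) (use that T F A_nonneg in auto)
  have \<alpha>_lim: "\<exists>v. \<forall>t \<in> T. v \<le> t \<longrightarrow> c \<le> \<alpha> t" for c using filterlim_at_top_in[OF assms(8)] .
  have F_lim: "\<exists>v. \<forall>t \<in> T. v \<le> t \<longrightarrow> c \<le> F t" for c
    using filterlim_at_top_in[OF assms(12), of "c - F t0"] by (auto simp: delta_integral_def F_def[symmetric])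

  \<comment> \<open>The real \<open>Inf\<close> in \<open>lower_delay\<close> is meaningful only for
    sets bounded below. Divergence of \<open>\<alpha>\<close> gives this from \<open>w\<close> on,
    and rd-continuity on the compact rest.\<close>
  obtain w where w: "\<And>t. t \<in> T \<Longrightarrow> w \<le> t \<Longrightarrow> 0 \<le> \<alpha> t" using \<alpha>_lim by blast
  obtain M where M: "\<And>t. t \<in> T \<inter> {t0..w} \<Longrightarrow> \<bar>\<alpha> t\<bar> \<le> M"
    using rd_continuous_on_bounded[OF T rd_continuous_on_subset_interval[OF assms(7)]] by blast
  have \<alpha>_bdd: "bdd_below (\<alpha> ` (T \<inter> {t..}))" if "t0 \<le> t" for t
  proof (rule bdd_belowI2)
    show "min 0 (- M) \<le> \<alpha> r" if "r \<in> T \<inter> {t..}" for r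
      using w[of r] M[of r] that \<open>t0 \<le> t\<close> by (cases "w \<le> r") (auto simp: abs_le_iff min_le_iff_disj)
  qed
  have lower_le: "lower_delay T \<alpha> t \<le> \<alpha> r" if "t0 \<le> t" "r \<in> T" "t \<le> r" for t r
    unfolding lower_delay_def by (rule cInf_lower[OF _ \<alpha>_bdd[OF that(1)]]) (use that in auto)
  have lower_in: "lower_delay T \<alpha> t \<in> T" if "t0 \<le> t" "t \<in> T" for t
  proof -
    have "\<alpha> ` (T \<inter> {t..}) \<subseteq> T" using \<alpha>_in that by auto
    then show ?thesis unfolding lower_delay_def
      by (intro closed_subset_contains_Inf[OF T _ _ \<alpha>_bdd[OF that(1)]]) (use that in auto)
  qed

  obtain \<kappa>0 where \<kappa>0: "\<kappa>0 < 1" "\<And>t. t \<in> ?S \<Longrightarrow> F t - F (max t0 (lower_delay T \<alpha> t)) \<le> \<kappa>0"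
    using SUP_ereal_less[OF assms(13)] by (auto simp: delta_integral_def F_def[symmetric] one_ereal_def)
  obtain C where C: "\<And>s. s \<in> ?S \<Longrightarrow> F (delay_inverse T t0 \<alpha> s) - F s \<le> C"
    using SUP_ereal_less[OF assms(11)] by (auto simp: delta_integral_def F_def[symmetric])
  \<comment> \<open>The locale asks for a positive constant, which \<open>1/2\<close> ensures
    without leaving \<open>(0, 1)\<close>.\<close>
  define \<kappa> where "\<kappa> = max \<kappa>0 (1/2)"

  interpret delay_equation T t0 A \<alpha> F \<kappa>
  proof
    fix r c assume r: "r \<in> T" "t0 \<le> r" and c: "c \<in> T" "t0 \<le> c" "\<alpha> r \<le> c"
    \<comment> \<open>Since \<open>\<alpha> r\<close> itself takes part in the infimum, the clipped
      infimum is at most \<open>c\<close>, and monotonicity of \<open>F\<close> applies.\<close>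
    have "max t0 (lower_delay T \<alpha> r) \<in> T" using lower_in[of r] r t0 by (simp add: max_def)
    moreover have "max t0 (lower_delay T \<alpha> r) \<le> c" using lower_le[of r r] r c by simp
    ultimately have "F (max t0 (lower_delay T \<alpha> r)) \<le> F c" using c by (intro F_mono) auto
    then show "F r - F c \<le> \<kappa>" using \<kappa>0(2)[of r] r by (simp add: \<kappa>_def)
  qed (use T unbounded t0 A_nonneg \<alpha>_in \<alpha>_lim F F_lim delay assms(10) \<kappa>0(1) in \<open>auto simp: \<kappa>_def\<close>)

  have inverse: "delay_inverse T t0 \<alpha> s \<in> T" "s \<le> delay_inverse T t0 \<alpha> s"
      "\<And>r. r \<in> T \<Longrightarrow> delay_inverse T t0 \<alpha> s < r \<Longrightarrow> s \<le> \<alpha> r" if s: "s \<in> T" "t0 \<le> s" for s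
  proof -
    let ?D = "{\<eta> \<in> ?S. lower_delay T \<alpha> \<eta> \<le> s}"
    have sD: "s \<in> ?D" using lower_le[of s s] \<alpha>_le[of s] s by auto
    \<comment> \<open>The margin \<open>1\<close> survives the passage to the infimum, which puts
      \<open>lower_delay T \<alpha> \<eta>\<close> strictly above \<open>s\<close> for late
      \<open>\<eta>\<close>.\<close>
    obtain v where v: "\<And>t. t \<in> T \<Longrightarrow> v \<le> t \<Longrightarrow> s + 1 \<le> \<alpha> t" using \<alpha>_lim by blast
    have bdd: "bdd_above ?D"
    proof (rule bdd_aboveI)
      fix \<eta> assume \<eta>: "\<eta> \<in> ?D"
      show "\<eta> \<le> v"
      proof (rule ccontr)
        assume "\<not> \<eta> \<le> v"
        then have "s + 1 \<le> lower_delay T \<alpha> \<eta>"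
          unfolding lower_delay_def using v \<eta> by (intro cInf_greatest) auto
        then show False using \<eta> by simp
      qed
    qed
    show "s \<le> delay_inverse T t0 \<alpha> s" unfolding delay_inverse_def by (rule cSup_upper[OF sD bdd])
    show "delay_inverse T t0 \<alpha> s \<in> T" unfolding delay_inverse_def
      by (rule closed_subset_contains_Sup[OF T _ _ bdd]) (use sD in auto)
    show "s \<le> \<alpha> r" if r: "r \<in> T" "delay_inverse T t0 \<alpha> s < r" for r
    proof (rule ccontr)
      assume n: "\<not> s \<le> \<alpha> r"
      have "t0 \<le> r" using r s \<open>s \<le> delay_inverse T t0 \<alpha> s\<close> by simp
      then have "r \<in> ?D" using lower_le[of r r] r n by auto
      then have "r \<le> delay_inverse T t0 \<alpha> s" unfolding delay_inverse_def using bdd by (rule cSup_upper)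
      then show False using r by simp
    qed
  qed

  have dde_solves: "solves s x" if "dde_solution T A \<alpha> s x0 \<phi> x" "t0 \<le> s" for s x0 \<phi> x
  proof -
    have "\<exists>x'. (\<forall>t \<in> T \<inter> {s..}. has_delta_deriv (T \<inter> {s..}) x (x' t) t) \<and>
        (\<forall>t \<in> T \<inter> {s..}. x' t + A t * x (\<alpha> t) = 0)"
      using that(1) unfolding dde_solution_def by blast
    then obtain x' where x': "\<forall>t \<in> T \<inter> {s..}. has_delta_deriv (T \<inter> {s..}) x (x' t) t"
        "\<forall>t \<in> T \<inter> {s..}. x' t + A t * x (\<alpha> t) = 0" by blast
    have "x' t = - (A t * x (\<alpha> t))" if "t \<in> T" "s \<le> t" for t
      using bspec[OF x'(2), of t] that by simp
    then show ?thesis using x'(1) that(2) unfolding solves_def by auto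
  qed

  have bound: "\<bar>x t\<bar> \<le> N * exp (C + 1)"
    if s: "s \<in> T" "t0 \<le> s" and x: "dde_solution T A \<alpha> s x0 \<phi> x"
      and N: "\<And>r. r \<in> T \<Longrightarrow> lower_delay T \<alpha> s \<le> r \<Longrightarrow> r \<le> s \<Longrightarrow> \<bar>x r\<bar> \<le> N"
      and t: "t \<in> T" "s \<le> t" for s x0 \<phi> x N t
  proof (rule solution_bound[OF dde_solves[OF x s(2)] s(1) inverse(1,2)[OF s] C inverse(3)[OF s] _ _ t])
    show "\<bar>x (\<alpha> r)\<bar> \<le> N" if "r \<in> T" "s \<le> r" "\<alpha> r < s" for r
      using N[of "\<alpha> r"] \<alpha>_in[of r] lower_le[OF s(2) that(1,2)] that s by auto
    show "\<bar>x s\<bar> \<le> N"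
      using N[of s] lower_le[of s s] \<alpha>_le[of s] s by auto
  qed (use s in auto)

  have "uniformly_stable T t0 A \<alpha>"
    unfolding uniformly_stable_def
  proof (intro allI impI)
    fix \<epsilon> :: real assume e: "\<epsilon> > 0"
    \<comment> \<open>The factor \<open>2\<close> leaves room for the strict inequality;
      \<open>C\<close> does not depend on \<open>s\<close>, hence neither does
      \<open>\<delta>\<close>.\<close>
    define \<delta> where "\<delta> = \<epsilon> / (2 * exp (C + 1))"
    have d: "\<delta> > 0" "\<delta> * exp (C + 1) < \<epsilon>" using e by (auto simp: \<delta>_def)
    show "\<exists>\<delta>>0. \<forall>s\<in>?S. \<forall>x0 \<phi> x. dde_solution T A \<alpha> s x0 \<phi> x \<longrightarrow>
        ennreal \<bar>x0\<bar> + (SUP \<eta>\<in>T \<inter> {lower_delay T \<alpha> s..<s}. ennreal \<bar>\<phi> \<eta>\<bar>) < ennreal \<delta> \<longrightarrow>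
        (\<forall>t\<in>T \<inter> {s..}. \<bar>x t\<bar> < \<epsilon>)"
    proof (intro exI[of _ \<delta>] conjI d(1) ballI allI impI)
      fix s x0 \<phi> x t
      assume s: "s \<in> ?S" and x: "dde_solution T A \<alpha> s x0 \<phi> x" and t: "t \<in> T \<inter> {s..}"
        and small: "ennreal \<bar>x0\<bar> + (SUP \<eta>\<in>T \<inter> {lower_delay T \<alpha> s..<s}. ennreal \<bar>\<phi> \<eta>\<bar>) < ennreal \<delta>"
      have "\<bar>x r\<bar> \<le> \<delta>" if r: "r \<in> T" "lower_delay T \<alpha> s \<le> r" "r \<le> s" for r
      proof (cases "r = s")
        case True
        have "ennreal \<bar>x0\<bar> \<le> ennreal \<bar>x0\<bar> + (SUP \<eta>\<in>T \<inter> {lower_delay T \<alpha> s..<s}. ennreal \<bar>\<phi> \<eta>\<bar>)" by simp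
        then have "ennreal \<bar>x0\<bar> \<le> ennreal \<delta>" using small by (meson less_imp_le order_trans)
        then show ?thesis using True x d by (simp add: dde_solution_def)
      next
        case False
        then have rI: "r \<in> T \<inter> {lower_delay T \<alpha> s..<s}" using r by auto
        have "ennreal \<bar>\<phi> r\<bar> \<le> (SUP \<eta>\<in>T \<inter> {lower_delay T \<alpha> s..<s}. ennreal \<bar>\<phi> \<eta>\<bar>)" using rI by (rule SUP_upper)
        also have "\<dots> \<le> ennreal \<bar>x0\<bar> + \<dots>" by simp
        finally have "ennreal \<bar>\<phi> r\<bar> \<le> ennreal \<delta>" using small by (meson less_imp_le order_trans)
        moreover have "x r = \<phi> r" using x rI unfolding dde_solution_def by blast
        ultimately show ?thesis using d by simp
      qed
      then have "\<bar>x t\<bar> \<le> \<delta> * exp (C + 1)" using bound[OF _ _ x] s t by auto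
      then show "\<bar>x t\<bar> < \<epsilon>" using d by simp
    qed
  qed
  moreover have "globally_attracting T t0 A \<alpha>"
    unfolding globally_attracting_def
  proof (intro ballI allI impI)
    fix s x0 \<phi> x assume s: "s \<in> ?S" and x: "dde_solution T A \<alpha> s x0 \<phi> x"
    \<comment> \<open>No smallness is assumed here; the initial data are bounded as an rd-continuous
      function on a compact interval.\<close>
    have "rd_continuous_on T (T \<inter> {lower_delay T \<alpha> s..s}) x" using x by (simp add: dde_solution_def)
    then obtain N where N: "\<And>r. r \<in> T \<inter> {lower_delay T \<alpha> s..s} \<Longrightarrow> \<bar>x r\<bar> \<le> N"
      using rd_continuous_on_bounded[OF T] by blast
    \<comment> \<open>The \<open>1\<close> makes the bound positive, as
      \<open>eventually_small\<close> requires; \<open>N\<close> may be zero.\<close>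
    define K where "K = max 1 (N * exp (C + 1))"
    have "\<bar>x r\<bar> \<le> K" if "r \<in> T" "s \<le> r" for r
      using bound[OF _ _ x _ that, of N] N s by (auto simp: K_def le_max_iff_disj)
    then have "\<exists>v. \<forall>r \<in> T. v \<le> r \<longrightarrow> \<bar>x r\<bar> < e" if "0 < e" for e
      using eventually_small[OF dde_solves[OF x], of K e] s that by (auto simp: K_def)
    then show "(x \<longlongrightarrow> 0) (at_top_in T)"
      unfolding tendsto_iff eventually_at_top_in by simp
  qed
  ultimately show ?thesis unfolding globally_asymptotically_stable_def ..
qed

end
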